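(* Let $\mathcal{C}$ be a clean tangled clutter where $\mathrm{conv}(\mathrm{setcore}(\mathcal{C}))$ is a simplex. If $\mathrm{rank}(\mathcal{C})>3$, then $\mathcal{C}$ has an $\mathbb{L}_7$ minor.
   Context: Clutters. A clutter over a finite ground set $V$ is a family $\mathcal{C}$ of subsets of $V$ (its members), none of which contains another. A cover is a subset of $V$ that intersects every member; the blocker $b(\mathcal{C})$ is the clutter over $V$ of the inclusion-wise minimal covers. The covering number $\tau(\mathcal{C})$ is the minimum cardinality of a cover; a minimum cover is a cover of cardinality $\tau(\mathcal{C})$. For disjoint $I,J\subseteq V$, the minor $\mathcal{C}\setminus I/J$ (delete $I$, contract $J$) is the clutter over $V-(I\cup J)$ whose members are the inclusion-wise minimal sets in $\{C-J: C\in\mathcal{C},\ C\cap I=\emptyset\}$. Clutters are identified up to relabeling of the ground set; in particular "has an $\mathbb{L}_7$ minor" means that some minor equals $\mathbb{L}_7$ after relabeling. Clean, tangled. A delta is a clutter over a ground set $\{a_1,\dots,a_n\}$, $n\ge 3$, whose members are $\{a_2,\dots,a_n\}$ and $\{a_1,a_i\}$, $i=2,\dots,n$. An extended odd hole is a clutter over a ground set $\{a_1,\dots,a_n\}$, $n\ge5$ odd, whose minimum cardinality members are exactly $\{a_1,a_2\},\{a_2,a_3\},\dots,\{a_{n-1},a_n\},\{a_n,a_1\}$ (other members of cardinality at least three may exist). A clutter is clean if it has no minor that is a delta or the blocker of an extended odd hole. A clutter is tangled if its covering number is two and every element belongs to a minimum cover. Core, rank and setcore. A fractional packing of $\mathcal{C}$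 is a vector $y\in\mathbb{R}^{\mathcal{C}}_+$ with $\sum(y_C: v\in C\in\mathcal{C})\le 1$ for all $v\in V$; its value is $\sum_C y_C$. Let $\mathcal{C}$ be clean tangled over $V$. $\mathrm{core}(\mathcal{C})=\{C\in\mathcal{C}: y_C>0\text{ for some fractional packing }y\text{ of value two}\}$. $G(\mathcal{C})$ is the graph on vertex set $V$ whose edges are the minimum covers of $\mathcal{C}$; it is known to be bipartite with no isolated vertex. $\mathrm{rank}(\mathcal{C})=r$ is its number of connected components; let $\{U_i,V_i\}$ be the bipartition of the $i$-th component, $i\in[r]$. Every $C\in\mathrm{core}(\mathcal{C})$ satisfies $C\cap(U_i\cup V_i)\in\{U_i,V_i\}$ for all $i$, and $\mathrm{setcore}(\mathcal{C})\subseteq\{0,1\}^r$ is the set of points $p$ obtained from the members $C\in\mathrm{core}(\mathcal{C})$ by letting $p_i=0$ if $C\cap(U_i\cup V_i)=U_i$ and $p_i=1$ if $C\cap(U_i\cup V_i)=V_i$. It is determined up to permuting coordinates and replacing $p_i$ by $1-p_i$ for all points in some coordinates $i$. $\mathbb{L}_7$ is the clutter over ground set $\{1,\dots,7\}$ with members $\{1,2,3\},\{1,4,5\},\{1,6,7\},\{2,5,6\},\{2,4,7\},\{3,4,6\},\{3,5,7\}$. *)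

theory Defs
  imports "HOL-Analysis.Analysis" "HOL-Library.Extended_Nat"
begin

text \<open>A clutter is given by its finite ground set \<open>V\<close> together with its family \<open>\<C>\<close> of members.\<close>

definition clutter :: "'a set \<Rightarrow> 'a set set \<Rightarrow> bool" where
  "clutter V \<C> \<longleftrightarrow> finite V \<and> \<C> \<subseteq> Pow V \<and> (\<forall>A\<in>\<C>. \<forall>B\<in>\<C>. \<not> A \<subset> B)"

definition minimal_sets :: "'a set set \<Rightarrow> 'a set set" where
  "minimal_sets F = {A \<in> F. \<forall>B\<in>F. \<not> B \<subset> A}"

definition covers :: "'a set \<Rightarrow> 'a set set \<Rightarrow> 'a set set" where
  "covers V \<C> = {B. B \<subseteq> V \<and> (\<forall>A\<in>\<C>. B \<inter> A \<noteq> {})}"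

definition blocker :: "'a set \<Rightarrow> 'a set set \<Rightarrow> 'a set set" where
  "blocker V \<C> = minimal_sets (covers V \<C>)"

text \<open>The covering number is \<open>\<infinity>\<close> if there is no cover, i.e. if the empty set is a member.\<close>

definition covering_number :: "'a set \<Rightarrow> 'a set set \<Rightarrow> enat" where
  "covering_number V \<C> = (INF B\<in>covers V \<C>. enat (card B))"

definition minimum_covers :: "'a set \<Rightarrow> 'a set set \<Rightarrow> 'a set set" where
  "minimum_covers V \<C> = {B \<in> covers V \<C>. enat (card B) = covering_number V \<C>}"

text \<open>Members of the minor deleting \<open>I\<close> and contracting \<open>J\<close>; its ground set is \<open>V - (I \<union> J)\<close>.\<close>

definition minor :: "'a set set \<Rightarrow> 'a set \<Rightarrow> 'a set \<Rightarrow> 'a set set" where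
  "minor \<C> I J = minimal_sets {A - J |A. A \<in> \<C> \<and> A \<inter> I = {}}"

definition delta :: "'a set \<Rightarrow> 'a set set \<Rightarrow> bool" where
  "delta V \<C> \<longleftrightarrow> (\<exists>(n::nat) a. 3 \<le> n \<and> bij_betw a {1..n} V \<and>
     \<C> = {a ` {2..n}} \<union> {{a 1, a i} |i. i \<in> {2..n}})"

definition extended_odd_hole :: "'a set \<Rightarrow> 'a set set \<Rightarrow> bool" where
  "extended_odd_hole V \<C> \<longleftrightarrow> clutter V \<C> \<and>
     (\<exists>(n::nat) a. 5 \<le> n \<and> odd n \<and> bij_betw a {1..n} V \<and>
        {A \<in> \<C>. \<forall>B\<in>\<C>. card A \<le> card B} =
        {{a i, a (i + 1)} |i. i \<in> {1..<n}} \<union> {{a n, a 1}})"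

definition clean :: "'a set \<Rightarrow> 'a set set \<Rightarrow> bool" where
  "clean V \<C> \<longleftrightarrow> (\<forall>I J. I \<subseteq> V \<longrightarrow> J \<subseteq> V \<longrightarrow> I \<inter> J = {} \<longrightarrow>
     \<not> delta (V - (I \<union> J)) (minor \<C> I J) \<and>
     \<not> (\<exists>\<D>. extended_odd_hole (V - (I \<union> J)) \<D> \<and>
             minor \<C> I J = blocker (V - (I \<union> J)) \<D>))"

definition tangled :: "'a set \<Rightarrow> 'a set set \<Rightarrow> bool" where
  "tangled V \<C> \<longleftrightarrow> covering_number V \<C> = 2 \<and> (\<forall>v\<in>V. \<exists>B\<in>minimum_covers V \<C>. v \<in> B)"

definition fractional_packing :: "'a set \<Rightarrow> 'a set set \<Rightarrow> ('a set \<Rightarrow> real) \<Rightarrow> bool" where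
  "fractional_packing V \<C> y \<longleftrightarrow>
     (\<forall>A\<in>\<C>. 0 \<le> y A) \<and> (\<forall>v\<in>V. (\<Sum>A\<in>{A \<in> \<C>. v \<in> A}. y A) \<le> 1)"

definition clutter_core :: "'a set \<Rightarrow> 'a set set \<Rightarrow> 'a set set" where
  "clutter_core V \<C> =
     {A \<in> \<C>. \<exists>y. fractional_packing V \<C> y \<and> (\<Sum>B\<in>\<C>. y B) = 2 \<and> 0 < y A}"

text \<open>
  The graph \<open>G(\<C>)\<close> as a symmetric adjacency relation on \<open>V\<close>. It is only used when the covering
  number is two, so that the minimum covers are two-element sets. Its connected components are
  represented by their vertex sets.
\<close>

definition cover_graph :: "'a set \<Rightarrow> 'a set set \<Rightarrow> ('a \<times> 'a) set" where
  "cover_graph V \<C> = {(u, v). {u, v} \<in> minimum_covers V \<C>}"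

definition graph_components :: "'a set \<Rightarrow> 'a set set \<Rightarrow> 'a set set" where
  "graph_components V \<C> = V // (cover_graph V \<C>)\<^sup>*"

definition clutter_rank :: "'a set \<Rightarrow> 'a set set \<Rightarrow> nat" where
  "clutter_rank V \<C> = card (graph_components V \<C>)"

text \<open>
  An enumeration of the components of \<open>G(\<C>)\<close> by the index type \<open>'r\<close>, together with an ordered
  bipartition \<open>(U i, W i)\<close> of the \<open>i\<close>-th component. This fixes the order of the coordinates and
  the orientation of each of them, which are the choices the setcore depends on. It forces
  \<open>CARD('r)\<close> to be the rank, so the setcore lives in \<open>real ^ 'r\<close>.
\<close>

definition component_bipartitions ::
    "'a set \<Rightarrow> 'a set set \<Rightarrow> ('r::finite \<Rightarrow> 'a set) \<Rightarrow> ('r \<Rightarrow> 'a set) \<Rightarrow> bool" where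
  "component_bipartitions V \<C> U W \<longleftrightarrow>
     bij_betw (\<lambda>i. U i \<union> W i) UNIV (graph_components V \<C>) \<and>
     (\<forall>i. U i \<inter> W i = {} \<and>
        (\<forall>(u, v)\<in>cover_graph V \<C>. \<not> (u \<in> U i \<and> v \<in> U i) \<and> \<not> (u \<in> W i \<and> v \<in> W i)))"

definition setcore ::
    "'a set \<Rightarrow> 'a set set \<Rightarrow> ('r::finite \<Rightarrow> 'a set) \<Rightarrow> ('r \<Rightarrow> 'a set) \<Rightarrow> (real ^ 'r) set" where
  "setcore V \<C> U W = {p. \<exists>A\<in>clutter_core V \<C>. \<forall>i.
     A \<inter> (U i \<union> W i) = U i \<and> p $ i = 0 \<or> A \<inter> (U i \<union> W i) = W i \<and> p $ i = 1}"

definition clutter_iso :: "'a set \<Rightarrow> 'a set set \<Rightarrow> 'b set \<Rightarrow> 'b set set \<Rightarrow> bool" where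
  "clutter_iso V \<C> V' \<C>' \<longleftrightarrow> (\<exists>f. bij_betw f V V' \<and> (`) f ` \<C> = \<C>')"

definition has_minor :: "'a set \<Rightarrow> 'a set set \<Rightarrow> 'b set \<Rightarrow> 'b set set \<Rightarrow> bool" where
  "has_minor V \<C> V' \<C>' \<longleftrightarrow> (\<exists>I J. I \<subseteq> V \<and> J \<subseteq> V \<and> I \<inter> J = {} \<and>
     clutter_iso (V - (I \<union> J)) (minor \<C> I J) V' \<C>')"

definition L7 :: "nat set set" where
  "L7 = {{1, 2, 3}, {1, 4, 5}, {1, 6, 7}, {2, 5, 6}, {2, 4, 7}, {3, 4, 6}, {3, 5, 7}}"

end

theory Submission
  imports Defs
begin

text \<open>
  If a clean clutter has covering number at least two, it has a fractional packing of value two: delete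
  one side of a component of the graph of two-element covers and contract the other side, do the same
  with the sides exchanged, and average. Cleanness excludes a cover consisting of one side and one
  more element, as shortening an even walk between two elements of such a cover would expose a delta
  or an odd hole in the blocker.

  Applied to the minors that fix one coordinate, this shows that the barycentric coordinates of the
  centre with respect to the simplex make the coordinates pairwise independent fair bits. If some two
  sides could be deleted together, uniqueness of affine representations would produce a negative
  weight. Hence two sides and one further element always form a cover, which forces every two
  coordinates to have a third one that is their sum, as in a projective geometry over the two-element
  field. The same packing argument allows every component to be shrunk to a single edge while all
  lines keep giving covers. With rank greater than three there is a Fano plane of coordinates, and
  contracting everything except one vertex in each of its seven components leaves \<open>L7\<close>.
\<close>

text \<open>Minors are formed only where an excluded minor or \<open>L7\<close> itself has to be
  exhibited. Elsewhere \<open>cov (I \<union> Z)\<close> expresses that \<open>Z\<close> covers the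
  minor deleting \<open>I\<close>, so statements about minors become statements about covers of \<C>
  enlarged by a fixed set. Packings are scaled to total weight one and read as probability
  distributions on members. An element has probability at most 1/2, and a two-element cover forces
  equality and makes its two elements complementary. The simplex hypothesis makes the distribution
  on the core unique, so every averaging construction computes moments of the same
  \<open>lam\<close>. A triple of coordinates with a missing pattern has third moment 1 or -1, and
  this is a linear relation between the three bits. Covers made of whole sides are not yet
  three-element covers: vertices picked for different lines need not agree. This is overcome by
  finding on each side one vertex that serves all lines through its coordinate. Comparing two such
  lines takes a coordinate off the first one, which exists when the rank exceeds three.\<close>

definition hits :: "'a set set \<Rightarrow> 'a set \<Rightarrow> bool" where
  "hits \<C> X \<longleftrightarrow> (\<forall>A\<in>\<C>. X \<inter> A \<noteq> {})"

lemma hits_mono: "hits \<C> X \<Longrightarrow> X \<subseteq> Y \<Longrightarrow> hits \<C> Y"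
  unfolding hits_def by blast

section \<open>Minimal sets of a family\<close>

lemma minimal_sets_sub: "minimal_sets F \<subseteq> F"
  by (auto simp: minimal_sets_def)

lemma minimal_sets_below:
  assumes "finite A" "A \<in> F"
  shows "\<exists>B\<in>minimal_sets F. B \<subseteq> A"
  using assms
proof (induction "card A" arbitrary: A rule: less_induct)
  case less
  show ?case
  proof (cases "A \<in> minimal_sets F")
    case False
    then obtain B where B: "B \<in> F" "B \<subset> A"
      using less.prems by (auto simp: minimal_sets_def)
    then obtain B' where "B' \<in> minimal_sets F" "B' \<subseteq> B"
      using less.hyps[of B] less.prems psubset_card_mono[of A B] finite_subset[of B A] by blast
    then show ?thesis using B by blast
  qed blast
qed

lemma minimal_sets_eqI:
  assumes "\<And>A. A \<in> F \<Longrightarrow> \<exists>B\<in>M. B \<subseteq> A" "M \<subseteq> F" "\<And>A B. A \<in> M \<Longrightarrow> B \<in> M \<Longrightarrow> \<not> A \<subset> B"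
  shows "minimal_sets F = M"
proof (intro equalityI subsetI)
  fix A assume "A \<in> minimal_sets F"
  then have A: "A \<in> F" "\<And>B. B \<in> F \<Longrightarrow> \<not> B \<subset> A" by (auto simp: minimal_sets_def)
  obtain B where "B \<in> M" "B \<subseteq> A" using assms(1) A(1) by blast
  then show "A \<in> M" using A(2)[of B] assms(2) by blast
next
  fix A assume A: "A \<in> M"
  have "\<not> B \<subset> A" if "B \<in> F" for B
  proof
    assume "B \<subset> A"
    moreover obtain B' where "B' \<in> M" "B' \<subseteq> B" using assms(1) \<open>B \<in> F\<close> by blast
    ultimately show False using assms(3)[OF \<open>B' \<in> M\<close> A] by blast
  qed
  then show "A \<in> minimal_sets F" using A assms(2) unfolding minimal_sets_def by blast
qed

section \<open>Excluded configurations of covers\<close>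

locale clean_family =
  fixes V :: "'a set" and \<C> :: "'a set set"
  assumes finV: "finite V" and sub: "\<C> \<subseteq> Pow V" and cln: "clean V \<C>"
begin

abbreviation "cov \<equiv> hits \<C>"

text \<open>Delete \<open>I\<close> and contract everything outside \<open>insert e D\<close>. A
  trace containing \<open>e\<close> must meet \<open>D\<close>, and one without \<open>e\<close>
  must contain \<open>D\<close>, so the sets of the delta lie below all traces. The two kinds of
  non-covers supply members whose traces are exactly \<open>D\<close> and the pairs
  \<open>{e, d}\<close>.\<close>

lemma no_delta_configuration:
  assumes V: "I \<subseteq> V" "D \<subseteq> V" "e \<in> V"
    and disj: "I \<inter> insert e D = {}" "e \<notin> D" and card: "2 \<le> card D"
    and covs: "\<And>d. d \<in> D \<Longrightarrow> cov (I \<union> {e, d})" "cov (I \<union> D)"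
    and ncov: "\<not> cov (insert e I)" "\<And>d. d \<in> D \<Longrightarrow> \<not> cov (I \<union> (D - {d}))"
  shows False
proof -
  let ?E = "insert e D"
  define J where "J = V - (I \<union> ?E)"
  have finD: "finite D" using V finV finite_subset by blast
  have two: "\<exists>d'\<in>D. d' \<noteq> d" for d
  proof (rule ccontr)
    assume "\<not> ?thesis"
    then have "D \<subseteq> {d}" by blast
    then have "card D \<le> 1" using card_mono[of "{d}" D] by simp
    then show False using card by simp
  qed
  have ground: "V - (I \<union> J) = ?E" using V disj unfolding J_def by blast
  have minus: "A - J = A \<inter> ?E" if "A \<in> \<C>" "A \<inter> I = {}" for A
    using that sub V unfolding J_def by blast
  have min: "minor \<C> I J = insert D ((\<lambda>d. {e, d}) ` D)"
    unfolding minor_def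
  proof (rule minimal_sets_eqI)
    fix B assume "B \<in> {A - J |A. A \<in> \<C> \<and> A \<inter> I = {}}"
    then obtain A where A: "A \<in> \<C>" "A \<inter> I = {}" "B = A \<inter> ?E" using minus by blast
    show "\<exists>M\<in>insert D ((\<lambda>d. {e, d}) ` D). M \<subseteq> B"
    proof (cases "e \<in> A")
      case True
      obtain d where "d \<in> D" "d \<in> A" using covs(2) A unfolding hits_def by blast
      then have "{e, d} \<subseteq> B" using True A by blast
      then show ?thesis using \<open>d \<in> D\<close> by blast
    next
      case False
      have "D \<subseteq> B"
      proof
        fix d assume "d \<in> D"
        then have "(I \<union> {e, d}) \<inter> A \<noteq> {}" using covs(1) A(1) unfolding hits_def by blast
        then show "d \<in> B" using A False \<open>d \<in> D\<close> by blast
      qed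
      then show ?thesis by blast
    qed
  next
    have "D \<in> {A - J |A. A \<in> \<C> \<and> A \<inter> I = {}}"
    proof -
      obtain A where A: "A \<in> \<C>" "A \<inter> I = {}" "e \<notin> A" using ncov(1) unfolding hits_def by blast
      have "D \<subseteq> A"
      proof
        fix d assume "d \<in> D"
        then have "(I \<union> {e, d}) \<inter> A \<noteq> {}" using covs(1) A(1) unfolding hits_def by blast
        then show "d \<in> A" using A by blast
      qed
      then have "A \<inter> ?E = D" using A(3) by (simp add: Int_absorb1)
      then have "D = A - J" using minus[OF A(1,2)] by simp
      then show ?thesis using A by blast
    qed
    moreover have "{e, d} \<in> {A - J |A. A \<in> \<C> \<and> A \<inter> I = {}}" if d: "d \<in> D" for d
    proof -
      obtain A where A: "A \<in> \<C>" "A \<inter> I = {}" "A \<inter> (D - {d}) = {}"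
        using ncov(2)[OF d] unfolding hits_def by blast
      have "(I \<union> D) \<inter> A \<noteq> {}" using covs(2) A(1) unfolding hits_def by blast
      then have "d \<in> A" using A by blast
      \<comment> \<open>\<open>A\<close> misses \<open>d'\<close>, so it can meet the cover
        containing \<open>e\<close> and \<open>d'\<close> only in \<open>e\<close>.\<close>
      obtain d' where d': "d' \<in> D" "d' \<noteq> d" using two by blast
      have "(I \<union> {e, d'}) \<inter> A \<noteq> {}" using covs(1)[OF d'(1)] A(1) unfolding hits_def by blast
      then have "e \<in> A" using A d' by blast
      then have "{e, d} = A - J" using minus[OF A(1,2)] A(3) \<open>d \<in> A\<close> d by blast
      then show ?thesis using A by blast
    qed
    ultimately show "insert D ((\<lambda>d. {e, d}) ` D) \<subseteq> {A - J |A. A \<in> \<C> \<and> A \<inter> I = {}}" by blast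
  next
    fix A B assume AB: "A \<in> insert D ((\<lambda>d. {e, d}) ` D)" "B \<in> insert D ((\<lambda>d. {e, d}) ` D)"
    have "card {e, d} = 2" if "d \<in> D" for d using disj(2) that by (auto simp: card_2_iff)
    moreover have "\<not> D \<subset> {e, d}" if "d \<in> D" for d using disj(2) two[of d] that by auto
    moreover have "\<not> {e, d} \<subset> D" for d using disj(2) by auto
    ultimately show "\<not> A \<subset> B"
      using AB psubset_card_mono[of B A] by auto
  qed
  define n where "n = card D + 1"
  obtain h where h: "bij_betw h {2..n} D"
    using finD finite_same_card_bij[of "{2..n}" D] unfolding n_def by auto
  define a where "a = h(1 := e)"
  have ah: "a i = h i" if "i \<in> {2..n}" for i using that unfolding a_def by auto
  have aD: "a ` {2..n} = D" using h ah by (metis bij_betw_imp_surj_on image_cong)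
  have "delta ?E (minor \<C> I J)"
    unfolding delta_def
  proof (intro exI conjI)
    show "3 \<le> n" using card n_def by simp
    have "inj_on a {2..n}"
      using bij_betw_imp_inj_on[OF h] ah unfolding inj_on_def by metis
    moreover have "a 1 \<notin> a ` {2..n}" using aD disj(2) by (simp add: a_def)
    ultimately have "bij_betw a (insert 1 {2..n}) (insert (a 1) D)"
      using aD by (simp add: bij_betw_def inj_on_insert)
    moreover have "insert 1 {2..n} = {1..n}" unfolding n_def by auto
    ultimately show "bij_betw a {1..n} ?E" by (simp add: a_def)
    have "a 1 = e" unfolding a_def by simp
    have "{{a 1, a i} |i. i \<in> {2..n}} = (\<lambda>d. {e, d}) ` (a ` {2..n})"
      unfolding \<open>a 1 = e\<close> by blast
    then have "insert D ((\<lambda>d. {e, d}) ` D) = {a ` {2..n}} \<union> {{a 1, a i} |i. i \<in> {2..n}}"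
      unfolding aD by (metis insert_is_Un)
    then show "minor \<C> I J = {a ` {2..n}} \<union> {{a 1, a i} |i. i \<in> {2..n}}"
      unfolding min .
  qed
  moreover have "J \<subseteq> V" "I \<inter> J = {}" unfolding J_def by blast+
  ultimately show False using cln V ground unfolding clean_def by metis
qed

text \<open>The minor is recognised from its covers: \<open>\<D>\<close> consists of the minimal
  \<open>X\<close> for which \<open>I \<union> X\<close> is a cover, and since no singleton
  qualifies, its smallest members are the pairs of consecutive vertices. A clutter is the blocker of
  its blocker, so the minor is the blocker of \<open>\<D>\<close>.\<close>

lemma no_odd_hole_configuration:
  fixes a :: "nat \<Rightarrow> 'a"
  assumes n: "5 \<le> n" "odd n" and inj: "inj_on a {0..<n}"
    and V: "I \<subseteq> V" "a ` {0..<n} \<subseteq> V" and disj: "I \<inter> a ` {0..<n} = {}"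
    and singles: "\<And>i. i < n \<Longrightarrow> \<not> cov (I \<union> {a i})"
    and pairs: "\<And>i j. i < j \<Longrightarrow> j < n \<Longrightarrow> cov (I \<union> {a i, a j}) \<longleftrightarrow> j = Suc i \<or> i = 0 \<and> j = n - 1"
  shows False
proof -
  define E where "E = a ` {0..<n}"
  define J where "J = V - (I \<union> E)"
  have ground: "V - (I \<union> J) = E" using V disj unfolding J_def E_def by blast
  have finE: "finite E" unfolding E_def by simp
  define F where "F = {A - J |A. A \<in> \<C> \<and> A \<inter> I = {}}"
  define N where "N = {X. X \<subseteq> E \<and> cov (I \<union> X)}"
  define \<D> where "\<D> = minimal_sets N"
  have minus: "A - J = A \<inter> E" if "A \<in> \<C>" "A \<inter> I = {}" for A
    using that sub V unfolding J_def by blast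
  have FE: "\<And>A. A \<in> F \<Longrightarrow> A \<subseteq> E" using minus unfolding F_def by blast
  have cover_iff: "cov (I \<union> X) \<longleftrightarrow> (\<forall>A\<in>F. X \<inter> A \<noteq> {})" if "X \<subseteq> E" for X
  proof -
    have "cov (I \<union> X) \<longleftrightarrow> (\<forall>A\<in>\<C>. A \<inter> I = {} \<longrightarrow> X \<inter> A \<noteq> {})"
      unfolding hits_def by blast
    also have "\<dots> \<longleftrightarrow> (\<forall>A\<in>\<C>. A \<inter> I = {} \<longrightarrow> X \<inter> (A - J) \<noteq> {})"
    proof -
      have "X \<inter> (A - J) = X \<inter> A" if "A \<in> \<C>" "A \<inter> I = {}" for A
        using \<open>X \<subseteq> E\<close> minus[OF that] by blast
      then show ?thesis by (metis (no_types, lifting))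
    qed
    also have "\<dots> \<longleftrightarrow> (\<forall>A\<in>F. X \<inter> A \<noteq> {})" unfolding F_def by blast
    finally show ?thesis .
  qed
  \<comment> \<open>Otherwise \<open>E - Y\<close> meets every trace, hence contains a minimal cover
    that \<open>Y\<close> misses.\<close>
  have above: "\<exists>A\<in>F. A \<subseteq> Y" if Y: "Y \<in> covers E \<D>" for Y
  proof (rule ccontr)
    assume "\<not> ?thesis"
    then have "\<forall>A\<in>F. (E - Y) \<inter> A \<noteq> {}" using FE by blast
    then have "E - Y \<in> N" using cover_iff[of "E - Y"] unfolding N_def by blast
    then obtain X where "X \<in> \<D>" "X \<subseteq> E - Y"
      using minimal_sets_below finE unfolding \<D>_def by (metis finite_Diff)
    then show False using Y unfolding covers_def by blast
  qed
  have F_covers: "F \<subseteq> covers E \<D>"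
  proof
    fix A assume A: "A \<in> F"
    have "A \<inter> X \<noteq> {}" if "X \<in> \<D>" for X
    proof -
      have "X \<subseteq> E" "cov (I \<union> X)" using that unfolding \<D>_def minimal_sets_def N_def by auto
      then show ?thesis using cover_iff A by blast
    qed
    then show "A \<in> covers E \<D>" using FE[OF A] unfolding covers_def by blast
  qed
  have "minimal_sets F = minimal_sets (covers E \<D>)"
  proof (rule minimal_sets_eqI[symmetric])
    fix Y assume "Y \<in> covers E \<D>"
    then obtain A where A: "A \<in> F" "A \<subseteq> Y" using above by blast
    then obtain B where "B \<in> minimal_sets F" "B \<subseteq> A"
      using minimal_sets_below[of A F] finite_subset[OF FE[OF A(1)] finE] by blast
    then show "\<exists>B\<in>minimal_sets F. B \<subseteq> Y" using A by blast
  next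
    show "minimal_sets F \<subseteq> covers E \<D>" using F_covers minimal_sets_sub by blast
  qed (auto simp: minimal_sets_def)
  then have blk: "minor \<C> I J = blocker E \<D>"
    unfolding minor_def blocker_def F_def .
  have small: "2 \<le> card X" if "X \<in> N" for X
  proof (rule ccontr)
    assume "\<not> 2 \<le> card X"
    moreover have finX: "finite X" using that finE finite_subset unfolding N_def by blast
    ultimately have "card X = 0 \<or> card X = 1" by linarith
    then obtain x where "x \<in> E" "X \<subseteq> {x}"
    proof
      assume "card X = 0"
      then have "X \<subseteq> {a 0}" using finX by simp
      moreover have "a 0 \<in> E" using n unfolding E_def by simp
      ultimately show thesis using that by blast
    next
      assume "card X = 1"
      then obtain x where "X = {x}" using card_1_singletonE by blast
      then show thesis using that \<open>X \<in> N\<close> unfolding N_def by blast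
    qed
    then obtain i where "i < n" "X \<subseteq> {a i}" unfolding E_def by auto
    then have "cov (I \<union> {a i})" using \<open>X \<in> N\<close> hits_mono[of \<C> "I \<union> X" "I \<union> {a i}"]
      unfolding N_def by blast
    then show False using singles \<open>i < n\<close> by blast
  qed
  have pairs_N: "{a i, a j} \<in> N \<longleftrightarrow> j = Suc i \<or> i = 0 \<and> j = n - 1" if "i < j" "j < n" for i j
    using pairs[OF that] that unfolding N_def E_def by auto
  have card2: "card {a i, a j} = 2" if "i < j" "j < n" for i j
    using inj_onD[OF inj, of i j] that by (simp add: card_2_iff) (metis card_2_iff less_irrefl)
  have inD: "X \<in> \<D>" if X: "X \<in> N" "card X = 2" for X
  proof -
    have "finite X" using X(2) by (metis card.infinite zero_neq_numeral)
    then have "\<not> Y \<subset> X" if "Y \<in> N" for Y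
      using psubset_card_mono[of X Y] small[OF that] X(2) by linarith
    then show ?thesis using X unfolding \<D>_def minimal_sets_def by blast
  qed
  have DN: "\<D> \<subseteq> N" unfolding \<D>_def by (rule minimal_sets_sub)
  have "{a 0, a 1} \<in> \<D>" using inD pairs_N[of 0 1] card2[of 0 1] n by simp
  then have "{A \<in> \<D>. \<forall>B\<in>\<D>. card A \<le> card B} = {A \<in> \<D>. card A = 2}"
  proof -
    have "card {a 0, a 1} = 2" using card2[of 0 1] n by simp
    then show ?thesis using small DN \<open>{a 0, a 1} \<in> \<D>\<close> by (metis (no_types, lifting) le_antisym subsetD)
  qed
  also have "\<dots> = {X \<in> N. card X = 2}" using inD DN by blast
  also have "\<dots> = {{a i, a j} |i j. i < j \<and> j < n \<and> (j = Suc i \<or> i = 0 \<and> j = n - 1)}"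
  proof (intro equalityI subsetI)
    fix X assume "X \<in> {X \<in> N. card X = 2}"
    then have X: "X \<in> N" "card X = 2" by auto
    then obtain x y where xy: "X = {x, y}" "x \<noteq> y" by (meson card_2_iff)
    then obtain i j where ij: "x = a i" "y = a j" "i < n" "j < n"
      using X unfolding N_def E_def by auto
    have "i \<noteq> j" using xy ij by blast
    then consider "i < j" | "j < i" by linarith
    then show "X \<in> {{a i, a j} |i j. i < j \<and> j < n \<and> (j = Suc i \<or> i = 0 \<and> j = n - 1)}"
    proof cases
      case 1 then show ?thesis using X xy ij pairs_N[of i j] by blast
    next
      case 2 
      moreover have "X = {a j, a i}" using xy ij by blast
      ultimately show ?thesis using X ij pairs_N[of j i] by blast
    qed
  qed (use pairs_N card2 in auto)
  finally have mins: "{A \<in> \<D>. \<forall>B\<in>\<D>. card A \<le> card B} =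
     {{a i, a j} |i j. i < j \<and> j < n \<and> (j = Suc i \<or> i = 0 \<and> j = n - 1)}" .
  \<comment> \<open>Shift to the indexing from 1 used in \<open>extended_odd_hole\<close>.\<close>
  define b where "b = (\<lambda>i. a (i - 1))"
  have "extended_odd_hole E \<D>"
    unfolding extended_odd_hole_def
  proof (intro conjI exI)
    show "clutter E \<D>" unfolding clutter_def using finE DN
      by (auto simp: N_def \<D>_def minimal_sets_def)
    show "5 \<le> n" "odd n" by fact+
    have "bij_betw (\<lambda>i. i - 1) {1..n} {0..<n}"
      by (rule bij_betwI[of _ _ _ Suc]) auto
    moreover have "bij_betw a {0..<n} E" unfolding E_def using inj by (simp add: bij_betw_def)
    ultimately show "bij_betw b {1..n} E"
      using bij_betw_trans unfolding b_def comp_def by blast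
    show "{A \<in> \<D>. \<forall>B\<in>\<D>. card A \<le> card B} = {{b i, b (i + 1)} |i. i \<in> {1..<n}} \<union> {{b n, b 1}}"
      unfolding mins
    proof (intro equalityI subsetI)
      fix X assume "X \<in> {{a i, a j} |i j. i < j \<and> j < n \<and> (j = Suc i \<or> i = 0 \<and> j = n - 1)}"
      then obtain i j where ij: "X = {a i, a j}" "i < j" "j < n" "j = Suc i \<or> i = 0 \<and> j = n - 1"
        by blast
      from ij(4) show "X \<in> {{b i, b (i + 1)} |i. i \<in> {1..<n}} \<union> {{b n, b 1}}"
      proof
        assume "j = Suc i"
        then have "X = {b (Suc i), b (Suc i + 1)}" "Suc i \<in> {1..<n}"
          using ij unfolding b_def by auto
        then show ?thesis by blast
      next
        assume "i = 0 \<and> j = n - 1"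
        then show ?thesis using ij unfolding b_def by auto
      qed
    next
      fix X assume "X \<in> {{b i, b (i + 1)} |i. i \<in> {1..<n}} \<union> {{b n, b 1}}"
      then consider i where "i \<in> {1..<n}" "X = {b i, b (i + 1)}" | "X = {b n, b 1}" by blast
      then show "X \<in> {{a i, a j} |i j. i < j \<and> j < n \<and> (j = Suc i \<or> i = 0 \<and> j = n - 1)}"
      proof cases
        case 1
        then have "X = {a (i - 1), a i} \<and> i - 1 < i \<and> i < n \<and> i = Suc (i - 1)"
          unfolding b_def by auto
        then show ?thesis by blast
      next
        case 2
        then have "X = {a 0, a (n - 1)} \<and> 0 < n - 1 \<and> n - 1 < n"
          using n unfolding b_def by auto
        then show ?thesis by blast
      qed
    qed
  qed
  moreover have "J \<subseteq> V" "I \<inter> J = {}" unfolding J_def by blast+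
  ultimately show False using cln V(1) ground blk unfolding clean_def by metis
qed

end

section \<open>Walks in the graph of two-element covers\<close>

lemma relpow_sym:
  assumes "sym E" "(x, y) \<in> E ^^ n"
  shows "(y, x) \<in> E ^^ n"
  using assms(2)
proof (induction n arbitrary: y)
  case (Suc n)
  then obtain z where "(x, z) \<in> E ^^ n" "(z, y) \<in> E" by auto
  then have "(y, z) \<in> E" "(z, x) \<in> E ^^ n" using Suc.IH assms(1) by (auto dest: symD)
  then show ?case by (rule relpow_Suc_I2)
qed simp

lemma relpow_append: "(x, y) \<in> E ^^ m \<Longrightarrow> (y, z) \<in> E ^^ n \<Longrightarrow> (x, z) \<in> E ^^ (m + n)"
  by (auto simp: relpow_add)

context clean_family
begin

definition pair_graph :: "'a set \<Rightarrow> 'a set \<Rightarrow> ('a \<times> 'a) set" where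
  "pair_graph I R = {(x, y). x \<in> R \<and> y \<in> R \<and> cov (I \<union> {x, y})}"

lemma sym_pair_graph: "sym (pair_graph I R)"
  by (auto simp: pair_graph_def sym_def insert_commute)

text \<open>A shortest odd closed walk, over all base points, has no repeated vertex and no chord:
  either would split it into two closed walks of different parity, the odd one being shorter. Loops
  are singleton covers, so the length is at least 3; a triangle is a delta, and a longer walk is an
  odd hole.\<close>

lemma no_odd_closed_walk:
  assumes V: "I \<subseteq> V" "R \<subseteq> V" "I \<inter> R = {}"
    and singles: "\<And>x. x \<in> R \<Longrightarrow> \<not> cov (insert x I)" and "odd n"
  shows "(x, x) \<notin> pair_graph I R ^^ n"
proof
  define E where "E = pair_graph I R"
  assume "(x, x) \<in> pair_graph I R ^^ n"
  then have ex: "\<exists>n. odd n \<and> (\<exists>x. (x, x) \<in> E ^^ n)" using \<open>odd n\<close> E_def by blast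
  define k where "k = (LEAST n. odd n \<and> (\<exists>x. (x, x) \<in> E ^^ n))"
  obtain x where k: "odd k" "(x, x) \<in> E ^^ k" using LeastI_ex[OF ex] unfolding k_def by blast
  have min: "(y, y) \<notin> E ^^ m" if "m < k" "odd m" for m y
    using not_less_Least[of m] that unfolding k_def by blast
  obtain f where f: "f 0 = x" "f k = x" "\<And>i. i < k \<Longrightarrow> (f i, f (Suc i)) \<in> E"
    using k(2) unfolding relpow_fun_conv by blast
  have walk: "(f i, f j) \<in> E ^^ (j - i)" if "i \<le> j" "j \<le> k" for i j
    unfolding relpow_fun_conv using that f(3) by (intro exI[of _ "\<lambda>t. f (i + t)"]) auto
  have wrap: "(f j, f i) \<in> E ^^ (k - j + i)" if "i \<le> j" "j \<le> k" for i j
    using relpow_append[of "f j" "f k" "k - j" E "f i" i] walk[of j k] walk[of 0 i] that f(1,2)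
    by simp
  have E: "(u, v) \<in> E \<longleftrightarrow> u \<in> R \<and> v \<in> R \<and> cov (I \<union> {u, v})" for u v
    unfolding E_def pair_graph_def by simp
  have irrefl: "(u, u) \<notin> E" for u using E singles by auto
  have parity: "odd (j - i) \<or> odd (k - j + i)" if "i < j" "j < k" for i j
    using k(1) that by presburger
  have fR: "f i \<in> R" if "i < k" for i using f(3)[OF that] E by blast
  have "k \<noteq> 1" using k(2) irrefl by auto
  then have k3: "3 \<le> k" using k(1) by (cases k) (auto elim: oddE)
  have neq: "f i \<noteq> f j" if ij: "i < j" "j < k" for i j
  proof
    assume eq: "f i = f j"
    consider "odd (j - i)" | "odd (k - j + i)" using parity[OF ij] by blast
    then show False
    proof cases
      case 1 then show ?thesis using min[of "j - i"] walk[of i j] eq ij by auto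
    next
      case 2 then show ?thesis using min[of "k - j + i"] wrap[of i j] eq ij by auto
    qed
  qed
  have chord: "j = Suc i \<or> i = 0 \<and> j = k - 1" if ij: "i < j" "j < k" and c: "cov (I \<union> {f i, f j})" for i j
  proof -
    have e: "(f i, f j) \<in> E" "(f j, f i) \<in> E"
      using c fR ij by (simp_all add: E insert_commute)
    have "odd (Suc (j - i)) \<or> odd (Suc (k - j + i))" using k(1) ij by presburger
    then consider "odd (Suc (j - i))" | "odd (Suc (k - j + i))" by blast
    then show ?thesis
    proof cases
      case 1
      have "(f i, f i) \<in> E ^^ Suc (j - i)" using walk[of i j] e ij by (auto intro: relpow_Suc_I)
      then have "\<not> Suc (j - i) < k" using min 1 by blast
      then show ?thesis using ij by linarith
    next
      case 2
      have "(f j, f j) \<in> E ^^ Suc (k - j + i)" using wrap[of i j] e ij by (auto intro: relpow_Suc_I)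
      then have "\<not> Suc (k - j + i) < k" using min 2 by blast
      then show ?thesis using ij by linarith
    qed
  qed
  have edge: "cov (I \<union> {f i, f (Suc i)})" if "i < k" for i using f(3)[OF that] E by blast
  have last: "cov (I \<union> {f 0, f (k - 1)})"
    using edge[of "k - 1"] f(1,2) k3 by (simp add: insert_commute)
  have single: "\<not> cov (I \<union> {f i})" if "i < k" for i using singles[OF fR[OF that]] by simp
  show False
  proof (cases "k = 3")
    case True
    have d: "f 0 \<noteq> f 1" "f 0 \<noteq> f 2" "f 1 \<noteq> f 2" using neq[of 0 1] neq[of 0 2] neq[of 1 2] True by auto
    have r: "f 0 \<in> R" "f 1 \<in> R" "f 2 \<in> R" using fR True by auto
    have c: "cov (I \<union> {f 0, f 1})" "cov (I \<union> {f 1, f 2})" "cov (I \<union> {f 0, f 2})"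
      using edge[of 0] edge[of 1] last True by (auto simp: numeral_2_eq_2)
    have s: "\<not> cov (I \<union> {f 0})" "\<not> cov (I \<union> {f 1})" "\<not> cov (I \<union> {f 2})" using single True by auto
    show False
    proof (rule no_delta_configuration[of I "{f 1, f 2}" "f 0"])
      show "cov (I \<union> {f 0, z})" if "z \<in> {f 1, f 2}" for z using c that by auto
      have "{f 1, f 2} - {f 1} = {f 2}" "{f 1, f 2} - {f 2} = {f 1}" using d by auto
      then show "\<not> cov (I \<union> ({f 1, f 2} - {z}))" if "z \<in> {f 1, f 2}" for z
        using s(2,3) that by (elim insertE emptyE) simp_all
    qed (use V d r c s in auto)
  next
    case False
    then have "5 \<le> k" using k3 k(1) by presburger
    show False
    proof (rule no_odd_hole_configuration[of k f I])
      show "inj_on f {0..<k}" using neq by (auto simp: inj_on_def) (metis linorder_neqE_nat)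
      show "f ` {0..<k} \<subseteq> V" "I \<inter> f ` {0..<k} = {}" using fR V by auto
      show "cov (I \<union> {f i, f j}) \<longleftrightarrow> j = Suc i \<or> i = 0 \<and> j = k - 1" if "i < j" "j < k" for i j
        using chord[OF that] edge[of i] last that by auto
    qed (use \<open>5 \<le> k\<close> k V single in auto)
  qed
qed

text \<open>An element \<open>h\<close> of \<open>D\<close> that forms no cover with
  \<open>e\<close> is moved into \<open>I\<close>; then \<open>D - {h}\<close> is still a minimal
  cover relative to the new \<open>I\<close>. Once every element of \<open>D\<close> is paired with
  \<open>e\<close>, the configuration is a delta. The neighbours \<open>f\<close> and
  \<open>g\<close> are never moved and keep \<open>D\<close> from having fewer than two
  elements.\<close>

lemma no_common_neighbour:
  assumes "I \<subseteq> V" "D \<subseteq> V" "e \<in> V" "I \<inter> insert e D = {}" "e \<notin> D"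
    and "f \<in> D" "g \<in> D" "f \<noteq> g" "cov (I \<union> {e, f})" "cov (I \<union> {e, g})" "cov (I \<union> D)"
    and "\<not> cov (insert e I)" "\<And>d. d \<in> D \<Longrightarrow> \<not> cov (I \<union> (D - {d}))"
  shows False
  using assms
proof (induction "card D" arbitrary: I D rule: less_induct)
  case (less D I)
  note prems = less.prems
  have finD: "finite D" using prems(2) finV finite_subset by blast
  show ?case
  proof (cases "\<forall>d\<in>D. cov (I \<union> {e, d})")
    case True
    have "card {f, g} \<le> card D" using finD prems(6,7) by (intro card_mono) auto
    then have "2 \<le> card D" using prems(8) by simp
    then show ?thesis using True prems no_delta_configuration[of I D e] by blast
  next
    case False
    then obtain h where h: "h \<in> D" "\<not> cov (I \<union> {e, h})" by blast
    then have hfg: "h \<noteq> f" "h \<noteq> g" using prems by auto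
    show ?thesis
    proof (rule less.hyps[of "D - {h}" "insert h I"])
      show "card (D - {h}) < card D" using finD h(1) by (rule card_Diff1_less)
      show "cov (insert h I \<union> {e, f})" "cov (insert h I \<union> {e, g})"
        using prems(9,10) by (auto elim: hits_mono)
      have "insert h I \<union> (D - {h}) = I \<union> D" using h by blast
      then show "cov (insert h I \<union> (D - {h}))" using prems(11) by simp
      show "\<not> cov (insert e (insert h I))" using h(2) by (simp add: insert_commute)
      show "\<not> cov (insert h I \<union> (D - {h} - {d}))" if "d \<in> D - {h}" for d
      proof -
        have "insert h I \<union> (D - {h} - {d}) = I \<union> (D - {d})" using h that by blast
        then show ?thesis using prems(13) that by simp
      qed
    qed (use prems h hfg in auto)
  qed
qed

text \<open>Contracting a further element \<open>h\<close> of the cover (moving it into \<open>I\<close>) preserves the situation unless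
  \<open>h\<close> lies on the walk or forms a cover with one of its vertices. By minimality that vertex has
  odd index, and \<open>h\<close> then yields a shorter walk. In the end the cover is a pair, which closes the
  walk to an odd one.\<close>

lemma no_alternating_walk_in_minimum_cover:
  fixes x :: "nat \<Rightarrow> 'a"
  assumes "I \<subseteq> V" "S \<subseteq> V" "D \<subseteq> S" "D \<inter> I = {}" "cov (I \<union> D)"
    and "\<And>X. X \<subseteq> S \<Longrightarrow> cov (I \<union> X) \<Longrightarrow> card D \<le> card X"
    and "x 0 \<in> D" "x (2 * m) \<in> D" "x 0 \<noteq> x (2 * m)"
    and "\<And>i. i \<le> 2 * m \<Longrightarrow> x i \<in> V - I \<and> \<not> cov (insert (x i) I) \<and> (x i \<in> S \<longleftrightarrow> even i)"
    and "\<And>i. i < 2 * m \<Longrightarrow> cov (I \<union> {x i, x (Suc i)})"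
  shows False
  using assms
proof (induction "m + card D" arbitrary: m D I S x rule: less_induct)
  case (less m D I S x)
  note prems = less.prems
  have finS: "finite S" using prems(2) finV finite_subset by blast
  have finD: "finite D" using prems(3) finS finite_subset by blast
  have "m \<noteq> 0" using prems(9) by (metis mult_0_right)
  have card_ge: "card D \<le> card {a, b}" if "a \<in> S" "b \<in> S" "cov (I \<union> {a, b})" for a b
    using prems(6)[of "{a, b}"] that by blast
  have pair: "card D \<le> 2" if "a \<in> S" "b \<in> S" "cov (I \<union> {a, b})" for a b
  proof -
    have "card {a, b} \<le> 2" by (simp add: card_insert_if)
    then show ?thesis using card_ge[OF that] by simp
  qed
  show False
  proof (cases "D = {x 0, x (2 * m)}")
    case True
    define R where "R = x ` {..2 * m}"
    have "(x 0, x (2 * m)) \<in> pair_graph I R ^^ (2 * m)"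
      unfolding relpow_fun_conv using prems(11)
      by (intro exI[of _ x]) (auto simp: pair_graph_def R_def)
    moreover have "(x (2 * m), x 0) \<in> pair_graph I R"
      using prems(5) True by (auto simp: pair_graph_def R_def insert_commute)
    ultimately have "(x 0, x 0) \<in> pair_graph I R ^^ Suc (2 * m)" by (rule relpow_Suc_I)
    moreover have "R \<subseteq> V" "I \<inter> R = {}" "\<And>y. y \<in> R \<Longrightarrow> \<not> cov (insert y I)"
      using prems(10) unfolding R_def by auto
    ultimately show ?thesis using no_odd_closed_walk[of I R "Suc (2 * m)" "x 0"] prems(1) by simp
  next
    case not2: False
    then obtain h where h: "h \<in> D" "h \<noteq> x 0" "h \<noteq> x (2 * m)" using prems(7,8) by blast
    have "card {x 0, x (2 * m), h} \<le> card D" using finD prems(7,8) h(1) by (intro card_mono) auto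
    then have card3: "3 \<le> card D" using h prems(9) by simp
    show ?thesis
    proof (cases "m = 1")
      case True
      have x1: "x 1 \<notin> S" "x 1 \<in> V" "x 1 \<notin> I" "\<not> cov (insert (x 1) I)" using prems(10)[of 1] True by auto
      \<comment> \<open>A walk of length two: \<open>x 1\<close> is a common neighbour of two
        elements of \<open>D\<close>, and \<open>D\<close>, being a minimum cover, is a minimal
        one.\<close>
      show ?thesis
      proof (rule no_common_neighbour[of I D "x 1" "x 0" "x 2"])
        show "cov (I \<union> {x 1, x 0})" "cov (I \<union> {x 1, x 2})"
          using prems(11)[of 0] prems(11)[of 1] True by (simp_all add: insert_commute numeral_2_eq_2)
        show "\<not> cov (I \<union> (D - {d}))" if "d \<in> D" for d
        proof
          assume "cov (I \<union> (D - {d}))"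
          then have "card D \<le> card (D - {d})" using prems(3,6) by blast
          then show False using card_Diff1_less[OF finD that] by simp
        qed
      qed (use prems True x1 in auto)
    next
      case False
      then have m2: "2 \<le> m" using \<open>m \<noteq> 0\<close> by simp
      have hS: "h \<in> S" using h prems(3) by blast
      show ?thesis
      proof (cases "\<exists>i\<le>2 * m. x i = h")
        case True
        then obtain i where i: "i \<le> 2 * m" "x i = h" by blast
        then have "even i" using prems(10) hS by blast
        then obtain l where l: "i = 2 * l" by (auto elim: evenE)
        have "l < m" using i l h(3) by (cases "l = m") auto
        show ?thesis
          by (rule less.hyps[of l D I S x]) (use \<open>l < m\<close> prems l i h in \<open>auto\<close>)
      next
        case off: False
        show ?thesis
        proof (cases "\<exists>i\<le>2 * m. cov (I \<union> {x i, h})")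
          case True
          then obtain i where i: "i \<le> 2 * m" "cov (I \<union> {x i, h})" by blast
          \<comment> \<open>Two elements of \<open>S\<close> cannot form a cover, since the minimum
            cover \<open>D\<close> has at least three elements.\<close>
          have "x i \<notin> S"
            using pair[of "x i" h] i hS card3 by auto
          then have "odd i" using prems(10) i by blast
          show ?thesis
          proof (cases "i + 1 < 2 * m")
            case True
            obtain l where l: "i + 1 = 2 * l" using \<open>odd i\<close> by (metis dvdE even_plus_one_iff odd_even_add odd_one)
            \<comment> \<open>The walk now ends at \<open>h\<close>, before reaching
              \<open>x (2 * m)\<close>.\<close>
            define y where "y = x(i + 1 := h)"
            have yx: "y t = x t" if "t < 2 * l" for t using that l unfolding y_def by auto
            have yl: "y (2 * l) = h" unfolding y_def l by simp
            show ?thesis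
            proof (rule less.hyps[of l D I S y])
              show "l + card D < m + card D" using True l by simp
              show "y 0 \<in> D" "y 0 \<noteq> y (2 * l)" using yx[of 0] yl l prems(7) h(2) by auto
              show "y (2 * l) \<in> D" using yl h by simp
              show "y t \<in> V - I \<and> \<not> cov (insert (y t) I) \<and> (y t \<in> S) = even t" if "t \<le> 2 * l" for t
              proof (cases "t = 2 * l")
                case True
                have "\<not> cov (insert h I)"
                  using prems(6)[of "{h}"] hS card3 by auto
                then show ?thesis using True yl h hS prems by auto
              next
                case False
                then show ?thesis using that yx[of t] prems(10)[of t] l \<open>i + 1 < 2 * m\<close> by auto
              qed
              show "cov (I \<union> {y t, y (Suc t)})" if "t < 2 * l" for t
              proof (cases "Suc t = 2 * l")
                case True
                then have "t = i" using l by simp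
                then show ?thesis using yx[of t] yl True i that by simp
              next
                case False
                then show ?thesis using yx[of t] yx[of "Suc t"] that prems(11)[of t] l \<open>i + 1 < 2 * m\<close> by simp
              qed
            qed (use prems in blast)+
          next
            case False
            then have i': "Suc i = 2 * m" using i \<open>odd i\<close> by (metis Suc_eq_plus1 Suc_lessI dvd_triv_left le_neq_implies_less)
            \<comment> \<open>If \<open>x i\<close> is the last vertex of odd index, ending the walk
              at \<open>h\<close> saves nothing. The other end is used instead: \<open>h\<close>,
              \<open>x i\<close>, \<open>x (2 * m)\<close> has length two, which is shorter because
              \<open>m\<close> is at least 2.\<close>
            define y where "y = (\<lambda>t::nat. if t = 0 then h else if t = 1 then x i else x (2 * m))"
            show ?thesis
            proof (rule less.hyps[of 1 D I S y])
              show "1 + card D < m + card D" using m2 by simp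
              show "y t \<in> V - I \<and> \<not> cov (insert (y t) I) \<and> (y t \<in> S) = even t" if "t \<le> 2 * 1" for t
              proof -
                have "\<not> cov (insert h I)" using prems(6)[of "{h}"] hS card3 by auto
                moreover have "t = 0 \<or> t = 1 \<or> t = 2" using that by auto
                ultimately show ?thesis
                  using prems(10)[of i] prems(10)[of "2 * m"] i(1) \<open>odd i\<close> h hS prems(2,4)
                  unfolding y_def by auto
              qed
              show "cov (I \<union> {y t, y (Suc t)})" if "t < 2 * 1" for t
              proof -
                have "t = 0 \<or> t = 1" using that by auto
                then show ?thesis using i prems(11)[of i] i' unfolding y_def by (auto simp: insert_commute)
              qed
            qed (use prems h y_def in auto)
          qed
        next
          case False
          show ?thesis
          proof (rule less.hyps[of m "D - {h}" "insert h I" "S - {h}" x])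
            show "m + card (D - {h}) < m + card D" using card_Diff1_less[OF finD h(1)] by simp
            have "insert h I \<union> (D - {h}) = I \<union> D" using h by blast
            then show "cov (insert h I \<union> (D - {h}))" using prems(5) by simp
            \<comment> \<open>Adding \<open>h\<close> back turns a relative cover \<open>X\<close>
              into one of the old situation, so \<open>D - {h}\<close> is still minimum.\<close>
            show "card (D - {h}) \<le> card X" if X: "X \<subseteq> S - {h}" "cov (insert h I \<union> X)" for X
            proof -
              have "finite X" "h \<notin> X" using X finS finite_subset by blast+
              moreover have "card D \<le> card (insert h X)" using prems(6)[of "insert h X"] X hS by auto
              ultimately show ?thesis using h(1) finD by simp
            qed
            show "x i \<in> V - insert h I \<and> \<not> cov (insert (x i) (insert h I)) \<and> (x i \<in> S - {h}) = even i"
              if "i \<le> 2 * m" for i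
              using prems(10)[OF that] off False that by (auto simp: insert_commute)
            show "cov (insert h I \<union> {x i, x (Suc i)})" if "i < 2 * m" for i
              using prems(11)[OF that] by (auto elim: hits_mono)
          qed (use prems h hS in auto)
        qed
      qed
    qed
  qed
qed

text \<open>Connectedness of a bipartite component, seen from its side \<open>U\<close>. It is
  stated for arbitrary sets so that it also applies to the shrunken components; for the side
  \<open>W\<close> the arguments are exchanged.\<close>

definition alt_conn :: "'a set \<Rightarrow> 'a set \<Rightarrow> 'a set \<Rightarrow> bool" where
  "alt_conn I U W \<longleftrightarrow> (\<forall>f\<in>U. \<forall>g\<in>U. \<exists>m x. x 0 = f \<and> x (2 * m) = g \<and>
     (\<forall>i\<le>2 * m. x i \<in> (if even i then U else W)) \<and> (\<forall>i<2 * m. cov (I \<union> {x i, x (Suc i)})))"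

text \<open>Take a smallest \<open>D\<close> inside \<open>T \<union> U\<close> that still covers
  together with \<open>I\<close>. Two elements of \<open>D\<close> in \<open>U\<close> would be
  joined by a walk that leaves and re-enters \<open>T \<union> U\<close> at every step, which
  \<open>no_alternating_walk_in_minimum_cover\<close> excludes. So one vertex of \<open>U\<close>
  does the work of the whole side.\<close>

lemma select_vertex:
  assumes V: "I \<subseteq> V" "T \<subseteq> V" "U \<subseteq> V" "W \<subseteq> V"
    and disj: "I \<inter> (T \<union> U \<union> W) = {}" "T \<inter> W = {}" "U \<inter> W = {}"
    and singles: "\<And>v. v \<in> U \<union> W \<Longrightarrow> \<not> cov (insert v I)"
    and conn: "alt_conn I U W" and ne: "U \<noteq> {}" and c: "cov (I \<union> T \<union> U)"
  shows "\<exists>u\<in>U. cov (insert u (I \<union> T))"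
proof -
  define S where "S = T \<union> U"
  have "S \<subseteq> S \<and> cov (I \<union> S)" using c by (simp add: S_def Un_assoc)
  from ex_has_least_nat[of "\<lambda>X. X \<subseteq> S \<and> cov (I \<union> X)", OF this, of card]
  obtain D where D: "D \<subseteq> S" "cov (I \<union> D)"
    and min: "\<And>X. X \<subseteq> S \<Longrightarrow> cov (I \<union> X) \<Longrightarrow> card D \<le> card X"
    by blast
  have "f = g" if fg: "f \<in> D \<inter> U" "g \<in> D \<inter> U" for f g
  proof (rule ccontr)
    assume "f \<noteq> g"
    obtain m x where x: "x 0 = f" "x (2 * m) = g" "\<And>i. i \<le> 2 * m \<Longrightarrow> x i \<in> (if even i then U else W)"
      "\<And>i. i < 2 * m \<Longrightarrow> cov (I \<union> {x i, x (Suc i)})"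
      using conn fg unfolding alt_conn_def by (metis IntE)
    show False
    proof (rule no_alternating_walk_in_minimum_cover[of I S D x m])
      show "x i \<in> V - I \<and> \<not> cov (insert (x i) I) \<and> (x i \<in> S) = even i" if "i \<le> 2 * m" for i
      proof (cases "even i")
        case True
        then have "x i \<in> U" using x(3)[OF that] by simp
        then show ?thesis using True V disj(1) singles unfolding S_def by blast
      next
        case False
        then have "x i \<in> W" using x(3)[OF that] by simp
        then show ?thesis using False V disj singles unfolding S_def by blast
      qed
    qed (use V D min fg x \<open>f \<noteq> g\<close> disj S_def in auto)
  qed
  then obtain u where "u \<in> U" "D \<inter> U \<subseteq> {u}" using ne by blast
  then have "I \<union> D \<subseteq> insert u (I \<union> T)" using D(1) unfolding S_def by blast
  then show ?thesis using D(2) hits_mono \<open>u \<in> U\<close> by blast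
qed

end

section \<open>Fractional packings of value two\<close>

context clean_family
begin

lemma fin\<C>: "finite \<C>"
  using finite_subset[OF sub] finV by simp

text \<open>Half of a fractional packing of value two of the minor that deletes \<open>I\<close> and keeps the ground set
  \<open>R\<close>, lifted to members of \<open>\<C>\<close>.\<close>

definition half_packing :: "'a set \<Rightarrow> 'a set \<Rightarrow> ('a set \<Rightarrow> real) \<Rightarrow> bool" where
  "half_packing I R w \<longleftrightarrow> (\<forall>A. 0 \<le> w A) \<and> (\<forall>A. w A \<noteq> 0 \<longrightarrow> A \<in> \<C> \<and> A \<inter> I = {}) \<and>
     sum w \<C> = 1 \<and> (\<forall>v\<in>R. sum w {A \<in> \<C>. v \<in> A} \<le> 1 / 2)"

definition walk_class :: "('a \<times> 'a) set \<Rightarrow> 'a \<Rightarrow> bool \<Rightarrow> 'a set" where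
  "walk_class E v b = {x. \<exists>n. even n = b \<and> (v, x) \<in> E ^^ n}"

text \<open>Reversing the walk to \<open>f\<close> and then following the one to \<open>g\<close>
  gives an even walk whose vertices have alternating parity as seen from \<open>v0\<close>.\<close>

lemma alt_conn_walk_class:
  "alt_conn I (walk_class (pair_graph I R) v0 b) (walk_class (pair_graph I R) v0 (\<not> b))"
  unfolding alt_conn_def
proof (intro ballI)
  let ?cls = "walk_class (pair_graph I R) v0"
  let ?E = "pair_graph I R"
  fix f g assume "f \<in> ?cls b" "g \<in> ?cls b"
  then obtain p q where p: "even p = b" "(v0, f) \<in> ?E ^^ p" and q: "even q = b" "(v0, g) \<in> ?E ^^ q"
    unfolding walk_class_def by blast
  have fg: "(f, g) \<in> ?E ^^ (p + q)"
    using relpow_append[OF relpow_sym[OF sym_pair_graph p(2)] q(2)] .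
  obtain m where m: "p + q = 2 * m" using p(1) q(1) by (metis dvdE even_add)
  obtain x where x: "x 0 = f" "x (2 * m) = g" "\<And>i. i < 2 * m \<Longrightarrow> (x i, x (Suc i)) \<in> ?E"
    using fg unfolding relpow_fun_conv m by blast
  have "x i \<in> (if even i then ?cls b else ?cls (\<not> b))" if "i \<le> 2 * m" for i
  proof -
    have "(f, x i) \<in> ?E ^^ i" unfolding relpow_fun_conv using x that by (intro exI[of _ x]) auto
    then have "(v0, x i) \<in> ?E ^^ (p + i)" using relpow_append[OF p(2)] by blast
    then have "x i \<in> ?cls (even (p + i))" unfolding walk_class_def by blast
    then show ?thesis using p(1) by (cases "even i") auto
  qed
  moreover have "cov (I \<union> {x i, x (Suc i)})" if "i < 2 * m" for i
    using x(3)[OF that] unfolding pair_graph_def by blast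
  ultimately show "\<exists>m x. x 0 = f \<and> x (2 * m) = g \<and>
      (\<forall>i\<le>2 * m. x i \<in> (if even i then ?cls b else ?cls (\<not> b))) \<and>
      (\<forall>i<2 * m. cov (I \<union> {x i, x (Suc i)}))"
    using x(1,2) by blast
qed

text \<open>Contracting one side and deleting the other side of a component of the graph of two-element
  covers creates no cover of size at most one, so the induction can average over both choices.\<close>

lemma half_packing_exists:
  assumes "I \<subseteq> V" "R \<subseteq> V" "I \<inter> R = {}" "\<not> cov I" "\<And>y. y \<in> R \<Longrightarrow> \<not> cov (insert y I)"
  shows "\<exists>w. half_packing I R w"
  using assms
proof (induction "card R" arbitrary: I R rule: less_induct)
  case (less R I)
  note prems = less.prems
  have finR: "finite R" using prems(2) finV finite_subset by blast
  show ?case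
  proof (cases "\<exists>v\<in>R. \<forall>x\<in>R. \<not> cov (I \<union> {v, x})")
    case True
    \<comment> \<open>An isolated \<open>v\<close> may be deleted: members avoiding it put no load
      on it.\<close>
    then obtain v where v: "v \<in> R" "\<And>x. x \<in> R \<Longrightarrow> \<not> cov (I \<union> {v, x})" by blast
    have "\<exists>w. half_packing (insert v I) (R - {v}) w"
    proof (rule less.hyps)
      show "card (R - {v}) < card R" using finR v(1) by (rule card_Diff1_less)
      show "\<not> cov (insert y (insert v I))" if "y \<in> R - {v}" for y
        using v(2)[of y] that by (simp add: insert_commute)
    qed (use prems v(1) in auto)
    then obtain w where w: "half_packing (insert v I) (R - {v}) w" by blast
    then have "w A = 0" if "v \<in> A" for A using that unfolding half_packing_def by blast
    then have "sum w {A \<in> \<C>. v \<in> A} = 0" by (intro sum.neutral) auto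
    then have "half_packing I R w" using w unfolding half_packing_def by (auto; blast)
    then show ?thesis by blast
  next
    case nbr: False
    show ?thesis
    proof (cases "R = {}")
      case True
      obtain A where A: "A \<in> \<C>" "A \<inter> I = {}" using prems(4) unfolding hits_def by blast
      have "half_packing I R (\<lambda>B. if B = A then 1 else 0)"
        unfolding half_packing_def using A True fin\<C> by auto
      then show ?thesis by blast
    next
      case False
      then obtain v0 where v0: "v0 \<in> R" by blast
      define E where "E = pair_graph I R"
      define cls where "cls = walk_class E v0"
      have cls: "x \<in> cls b \<longleftrightarrow> (\<exists>n. even n = b \<and> (v0, x) \<in> E ^^ n)" for x b
        unfolding cls_def walk_class_def by simp
      have symE: "sym E" unfolding E_def by (rule sym_pair_graph)
      obtain v1 where v1: "v1 \<in> R" "(v0, v1) \<in> E"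
        using nbr v0 unfolding E_def pair_graph_def by auto
      have ne: "cls b \<noteq> {}" for b
      proof (cases b)
        case True
        have "v0 \<in> cls b" unfolding cls using True by (auto intro: exI[of _ 0])
        then show ?thesis by blast
      next
        case False
        have "v1 \<in> cls b" unfolding cls using False v1 by (auto intro!: exI[of _ 1])
        then show ?thesis by blast
      qed
      have ER: "E \<subseteq> R \<times> R" unfolding E_def pair_graph_def by blast
      have clsR: "cls b \<subseteq> R" for b
      proof
        fix x assume "x \<in> cls b"
        then obtain n where "(v0, x) \<in> E ^^ n" unfolding cls by blast
        then show "x \<in> R" using v0 ER by (cases n) auto
      qed
      have step: "y \<in> cls (\<not> b)" if "x \<in> cls b" "(x, y) \<in> E" for x y b
        using that unfolding cls by (metis even_Suc relpow_Suc_I)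
      have disj: "cls b \<inter> cls (\<not> b) = {}" for b
      proof (rule ccontr)
        assume "\<not> ?thesis"
        then obtain x where "x \<in> cls b" "x \<in> cls (\<not> b)" by blast
        then obtain p q where "even p = b" "(v0, x) \<in> E ^^ p" "even q = (\<not> b)" "(v0, x) \<in> E ^^ q"
          unfolding cls by blast
        then have "(v0, v0) \<in> E ^^ (p + q)" "odd (p + q)"
          using relpow_append[OF _ relpow_sym[OF symE]] by auto
        then show False using no_odd_closed_walk[of I R "p + q" v0] prems unfolding E_def by blast
      qed
      have conn: "alt_conn I (cls b) (cls (\<not> b))" for b
        unfolding cls_def E_def by (rule alt_conn_walk_class)
      have sel: "\<exists>u\<in>cls b. cov (insert u (I \<union> T))"
        if "T \<subseteq> R" "T \<inter> cls (\<not> b) = {}" "cov (I \<union> T \<union> cls b)" for T b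
      proof (rule select_vertex[of I T "cls b" "cls (\<not> b)"])
        have "cls c \<subseteq> V" "I \<inter> cls c = {}" for c using clsR[of c] prems by blast+
        then show "cls b \<subseteq> V" "cls (\<not> b) \<subseteq> V" "I \<inter> (T \<union> cls b \<union> cls (\<not> b)) = {}"
          using that(1) prems(3) by blast+
        show "T \<subseteq> V" using that(1) prems(2) by blast
        show "\<not> cov (insert v I)" if "v \<in> cls b \<union> cls (\<not> b)" for v using that clsR prems(5) by blast
      qed (use prems that disj conn ne in auto)
      have nc: "\<not> cov (I \<union> cls b)" for b
      proof
        assume "cov (I \<union> cls b)"
        then obtain u where "u \<in> cls b" "cov (insert u I)" using sel[of "{}" b] by auto
        then show False using prems(5) clsR by blast
      qed
      \<comment> \<open>By \<open>sel\<close> the side would shrink to one vertex \<open>u\<close>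
        adjacent to \<open>y\<close>, but neighbours of \<open>cls b\<close> lie in
        \<open>cls (\<not> b)\<close>.\<close>
      have nc1: "\<not> cov (insert y (I \<union> cls b))" if y: "y \<in> R - cls (\<not> b)" for y b
      proof
        assume "cov (insert y (I \<union> cls b))"
        then have "cov (I \<union> {y} \<union> cls b)" by simp
        then obtain u where u: "u \<in> cls b" "cov (insert u (I \<union> {y}))" using sel[of "{y}" b] y by blast
        then have "(u, y) \<in> E" using y clsR unfolding E_def pair_graph_def by auto
        then show False using step u(1) y by blast
      qed
      have "\<exists>w. half_packing (I \<union> cls b) (R - cls b - cls (\<not> b)) w" for b
      proof (rule less.hyps)
        show "card (R - cls b - cls (\<not> b)) < card R"
          using finR ne[of b] clsR[of b] by (intro psubset_card_mono) auto
        show "I \<union> cls b \<subseteq> V" "R - cls b - cls (\<not> b) \<subseteq> V" "(I \<union> cls b) \<inter> (R - cls b - cls (\<not> b)) = {}"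
          using clsR[of b] prems by blast+
        show "\<not> cov (I \<union> cls b)" by (rule nc)
        show "\<not> cov (insert y (I \<union> cls b))" if "y \<in> R - cls b - cls (\<not> b)" for y
          using nc1[of y b] that by simp
      qed
      then obtain w where w: "\<And>b. half_packing (I \<union> cls b) (R - cls b - cls (\<not> b)) (w b)" by metis
      have pos: "0 \<le> w b A" and supp: "w b A \<noteq> 0 \<Longrightarrow> A \<in> \<C> \<and> A \<inter> (I \<union> cls b) = {}"
        and tot: "sum (w b) \<C> = 1" and load: "v \<in> R - cls b - cls (\<not> b) \<Longrightarrow> sum (w b) {A \<in> \<C>. v \<in> A} \<le> 1 / 2"
        for b A v using w[of b] unfolding half_packing_def by blast+
      \<comment> \<open>Each choice loads its deleted side by 0 and the opposite side by at most 1,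
        so the two choices average to at most 1/2.\<close>
      have half: "sum (w b) {A \<in> \<C>. v \<in> A} \<le> (if v \<in> cls b then 0 else if v \<in> cls (\<not> b) then 1 else 1 / 2)"
        if "v \<in> R" for b v
      proof -
        have "sum (w b) {A \<in> \<C>. v \<in> A} = 0" if "v \<in> cls b" using supp that by (intro sum.neutral) blast
        moreover have "sum (w b) {A \<in> \<C>. v \<in> A} \<le> sum (w b) \<C>"
          using pos fin\<C> by (intro sum_mono2) auto
        ultimately show ?thesis using tot[of b] load[of v b] \<open>v \<in> R\<close> by auto
      qed
      define w' where "w' = (\<lambda>A. (w True A + w False A) / 2)"
      have sumw': "sum w' X = (sum (w True) X + sum (w False) X) / 2" for X
        unfolding w'_def by (simp add: sum.distrib sum_divide_distrib[symmetric])
      have "half_packing I R w'"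
        unfolding half_packing_def
      proof (intro conjI allI impI ballI)
        show "0 \<le> w' A" for A unfolding w'_def using pos by simp
        fix A assume "w' A \<noteq> 0"
        then have "w True A \<noteq> 0 \<or> w False A \<noteq> 0" unfolding w'_def by auto
        then show "A \<in> \<C>" "A \<inter> I = {}" using supp by blast+
      next
        show "sum w' \<C> = 1" unfolding sumw' using tot by simp
        fix v assume "v \<in> R"
        then show "sum w' {A \<in> \<C>. v \<in> A} \<le> 1 / 2"
          using half[of v True] half[of v False] disj[of True] unfolding sumw' by (auto split: if_splits)
      qed
      then show ?thesis by blast
    qed
  qed
qed

text \<open>A member in the support avoids \<open>I\<close> and so meets \<open>{a, b}\<close>; the
  two loads therefore add up to at least 1, while each is at most 1/2. Equality leaves no weight for
  members containing both elements.\<close>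

lemma half_packing_edge:
  assumes w: "half_packing I R w" and ab: "a \<in> R" "b \<in> R" "cov (I \<union> {a, b})"
  shows "sum w {A \<in> \<C>. a \<in> A} = 1 / 2" "sum w {A \<in> \<C>. b \<in> A} = 1 / 2"
    and "\<And>A. w A \<noteq> 0 \<Longrightarrow> a \<in> A \<longleftrightarrow> b \<notin> A"
proof -
  let ?A = "{A \<in> \<C>. a \<in> A}" and ?B = "{A \<in> \<C>. b \<in> A}"
  have pos: "\<And>A. 0 \<le> w A" and supp: "\<And>A. w A \<noteq> 0 \<Longrightarrow> A \<in> \<C> \<and> A \<inter> I = {}"
    and tot: "sum w \<C> = 1" and load: "sum w ?A \<le> 1 / 2" "sum w ?B \<le> 1 / 2"
    using w ab(1,2) unfolding half_packing_def by blast+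
  have or: "a \<in> A \<or> b \<in> A" if "w A \<noteq> 0" for A
  proof -
    have "(I \<union> {a, b}) \<inter> A \<noteq> {}" using ab(3) supp[OF that] unfolding hits_def by blast
    then show ?thesis using supp[OF that] by blast
  qed
  have "sum w (?A \<union> ?B) = sum w \<C>"
    by (rule sum.mono_neutral_left) (use fin\<C> or in auto)
  moreover have "sum w (?A \<union> ?B) = sum w ?A + sum w ?B - sum w (?A \<inter> ?B)"
    using fin\<C> by (intro sum_Un) auto
  moreover have "0 \<le> sum w (?A \<inter> ?B)" using pos by (intro sum_nonneg)
  ultimately have eq: "sum w ?A = 1 / 2" "sum w ?B = 1 / 2" "sum w (?A \<inter> ?B) = 0"
    using load tot by auto
  show "sum w ?A = 1 / 2" "sum w ?B = 1 / 2" by fact+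
  fix A assume A: "w A \<noteq> 0"
  have "w A = 0" if "A \<in> ?A \<inter> ?B"
    using eq(3) sum_nonneg_eq_0_iff[of "?A \<inter> ?B" w] fin\<C> pos that by auto
  then show "a \<in> A \<longleftrightarrow> b \<notin> A" using or[OF A] supp[OF A] A by auto
qed

end

section \<open>Core members of a simplex\<close>

context clean_family
begin

text \<open>Membership in \<open>A\<close> flips along every edge, so it is constant on
  \<open>U\<close> by even walks, and every vertex of \<open>W\<close> has a neighbour in
  \<open>U\<close> and takes the opposite value.\<close>

lemma half_packing_side:
  assumes w: "half_packing I R w" "w A \<noteq> 0" and R: "U \<subseteq> R" "W \<subseteq> R" and conn: "alt_conn {} U W"
    and nbr: "\<And>x. x \<in> U \<Longrightarrow> \<exists>y\<in>W. cov {x, y}" "\<And>y. y \<in> W \<Longrightarrow> \<exists>x\<in>U. cov {x, y}"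
  shows "U \<subseteq> A \<and> W \<inter> A = {} \<or> W \<subseteq> A \<and> U \<inter> A = {}"
proof -
  have edge: "x \<in> A \<longleftrightarrow> y \<notin> A" if "x \<in> R" "y \<in> R" "cov {x, y}" for x y
    using half_packing_edge(3)[OF w(1) that(1,2) _ w(2)] hits_mono[OF that(3), of "I \<union> {x, y}"] by blast
  have "f \<in> A \<longleftrightarrow> g \<in> A" if fg: "f \<in> U" "g \<in> U" for f g
  proof -
    obtain m x where x: "x 0 = f" "x (2 * m) = g" "\<And>i. i \<le> 2 * m \<Longrightarrow> x i \<in> (if even i then U else W)"
      "\<And>i. i < 2 * m \<Longrightarrow> cov {x i, x (Suc i)}"
      using conn fg unfolding alt_conn_def by (metis sup_bot_left)
    have inR: "x i \<in> R" if "i \<le> 2 * m" for i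
      using x(3)[OF that] R by (cases "even i") auto
    have "x i \<in> A \<longleftrightarrow> (f \<in> A \<longleftrightarrow> even i)" if "i \<le> 2 * m" for i
      using that
    proof (induction i)
      case (Suc i)
      then show ?case using edge[OF inR[of i] inR[of "Suc i"] x(4)[of i]] by auto
    qed (simp add: x(1))
    from this[of "2 * m"] show ?thesis using x(2) by auto
  qed
  then have "U \<subseteq> A \<or> U \<inter> A = {}" by blast
  then show ?thesis
  proof
    assume U: "U \<subseteq> A"
    have "y \<notin> A" if y: "y \<in> W" for y
    proof -
      obtain x where "x \<in> U" "cov {x, y}" using nbr(2)[OF y] by blast
      then show ?thesis using edge[of x y] R U y by blast
    qed
    then show ?thesis using U by blast
  next
    assume U: "U \<inter> A = {}"
    have "y \<in> A" if y: "y \<in> W" for y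
    proof -
      obtain x where "x \<in> U" "cov {x, y}" using nbr(2)[OF y] by blast
      then show ?thesis using edge[of x y] R U y by blast
    qed
    then show ?thesis using U by blast
  qed
qed

end

text \<open>\<open>Y i False\<close> and \<open>Y i True\<close> are the two sides of the \<open>i\<close>-th component.\<close>

definition side :: "('r \<Rightarrow> bool \<Rightarrow> 'a set) \<Rightarrow> 'a set \<Rightarrow> 'r \<Rightarrow> bool \<Rightarrow> bool" where
  "side Y A i b \<longleftrightarrow> Y i b \<subseteq> A \<and> Y i (\<not> b) \<inter> A = {}"

abbreviation sgn_of :: "bool \<Rightarrow> real" where
  "sgn_of b \<equiv> (if b then 1 else - 1)"

text \<open>The member \<open>A0\<close> of the core fixes the orientation of the coordinates: its point is the origin.\<close>

locale simplex_core = clean_family V \<C> for V :: "'a set" and \<C> +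
  fixes X :: "'r::finite \<Rightarrow> bool \<Rightarrow> 'a set" and K :: "'a set set" and A0 :: "'a set"
  assumes X_V: "(\<Union>i b. X i b) = V"
    and X_disj: "v \<in> X i a \<Longrightarrow> v \<in> X j b \<Longrightarrow> i = j \<and> a = b"
    and X_ne: "X i b \<noteq> {}"
    and singles: "v \<in> V \<Longrightarrow> \<not> cov {v}"
    and edges: "x \<in> X i a \<Longrightarrow> y \<in> V \<Longrightarrow> cov {x, y} \<Longrightarrow> y \<in> X i (\<not> a)"
    and nbr: "x \<in> X i a \<Longrightarrow> \<exists>y\<in>X i (\<not> a). cov {x, y}"
    and conn: "alt_conn {} (X i a) (X i (\<not> a))"
    and K_iff: "A \<in> K \<longleftrightarrow> (\<exists>w. half_packing {} V w \<and> w A \<noteq> 0)"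
    and indep: "(\<Sum>A\<in>K. \<gamma> A) = 0 \<Longrightarrow> (\<And>i. (\<Sum>A\<in>K. \<gamma> A * of_bool (X i True \<subseteq> A)) = 0) \<Longrightarrow>
      A \<in> K \<Longrightarrow> \<gamma> A = (0::real)"
    and A0: "A0 \<in> K" "\<And>i. X i False \<subseteq> A0"
begin

definition val :: "'a set \<Rightarrow> 'r \<Rightarrow> bool" where
  "val A i \<longleftrightarrow> X i True \<subseteq> A"

lemma XV: "X i b \<subseteq> V" using X_V by blast

lemma nbr': "y \<in> X i (\<not> a) \<Longrightarrow> \<exists>x\<in>X i a. cov {x, y}"
  using nbr[of y i "\<not> a"] by (auto simp: insert_commute)

lemma half_packing_X:
  assumes "half_packing I R w" "w A \<noteq> 0" "\<And>b. X i b \<subseteq> R"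
  shows "side X A i (val A i)"
proof -
  have "X i True \<subseteq> A \<and> X i False \<inter> A = {} \<or> X i False \<subseteq> A \<and> X i True \<inter> A = {}"
    using half_packing_side[OF assms(1,2,3,3)] conn[of i True] nbr[of _ i True] nbr'[of _ i True] by simp
  then show ?thesis unfolding side_def val_def using X_ne[of i True] by (cases "X i True \<subseteq> A") auto
qed

lemma side_val: "side X A i b \<Longrightarrow> val A i = b"
  unfolding side_def val_def using X_ne[of i] by (cases b) auto

lemma K_C: "K \<subseteq> \<C>" using K_iff unfolding half_packing_def by blast

lemma finK: "finite K" using K_C fin\<C> finite_subset by blast

lemma K_side: "A \<in> K \<Longrightarrow> side X A i (val A i)"
  using K_iff half_packing_X XV by meson

lemma K_mem:
  assumes "A \<in> K" "v \<in> X i b"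
  shows "v \<in> A \<longleftrightarrow> val A i = b"
  using K_side[OF assms(1), of i] assms(2) unfolding side_def by (cases b; cases "val A i") auto

lemma A0_val: "\<not> val A0 i"
  using K_mem[OF A0(1), of _ i False] A0(2)[of i] X_ne[of i False] by auto

abbreviation sg :: "'a set \<Rightarrow> 'r \<Rightarrow> real" where
  "sg A i \<equiv> sgn_of (val A i)"

text \<open>Signs replace 0/1 values so that the coordinates have mean 0 and products of coordinates
  are again signs.\<close>

lemma indep_sg:
  assumes "(\<Sum>A\<in>K. \<gamma> A) = 0" "\<And>i. (\<Sum>A\<in>K. \<gamma> A * sg A i) = 0" "A \<in> K"
  shows "\<gamma> A = 0"
proof (rule indep[OF assms(1) _ assms(3)])
  fix i
  have "(\<Sum>A\<in>K. \<gamma> A * of_bool (X i True \<subseteq> A)) = (\<Sum>A\<in>K. (\<gamma> A + \<gamma> A * sg A i) / 2)"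
    by (rule sum.cong) (auto simp: val_def)
  also have "\<dots> = 0"
    using assms(1) assms(2)[of i] by (simp add: sum.distrib flip: sum_divide_distrib)
  finally show "(\<Sum>A\<in>K. \<gamma> A * of_bool (X i True \<subseteq> A)) = 0" .
qed

lemma half_packing_load:
  assumes "half_packing I R w" "\<And>b. X i b \<subseteq> R" "v \<in> X i b"
  shows "sum w {A \<in> \<C>. v \<in> A} = 1 / 2"
proof -
  obtain y where y: "y \<in> X i (\<not> b)" "cov {v, y}" using nbr[OF assms(3)] by blast
  then have "cov (I \<union> {v, y})" using hits_mono by blast
  then show ?thesis using half_packing_edge(1)[OF assms(1)] y assms by blast
qed

text \<open>The total weight is 1, and the members containing \<open>X i True\<close> carry weight
  1/2, the load of any vertex of that side.\<close>

lemma half_packing_mean: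
  assumes w: "half_packing I R w" and i: "\<And>b. X i b \<subseteq> R" and K: "\<And>A. w A \<noteq> 0 \<Longrightarrow> A \<in> K"
  shows "(\<Sum>A\<in>K. w A * sg A i) = 0"
proof -
  obtain v where v: "v \<in> X i True" using X_ne by blast
  have "(\<Sum>A\<in>K. w A * of_bool (val A i)) = (\<Sum>A\<in>{A \<in> K. v \<in> A}. w A)"
    using K_mem[OF _ v] finK by (intro sum.mono_neutral_cong_right) auto
  also have "\<dots> = (\<Sum>A\<in>{A \<in> \<C>. v \<in> A}. w A)"
    using K_C K fin\<C> by (intro sum.mono_neutral_left) auto
  also have "\<dots> = 1 / 2" using half_packing_load[OF w i v] .
  finally have half: "(\<Sum>A\<in>K. w A * of_bool (val A i)) = 1 / 2" .
  have "(\<Sum>A\<in>K. w A) = sum w \<C>" using K_C K fin\<C> by (intro sum.mono_neutral_left) auto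
  then have one: "(\<Sum>A\<in>K. w A) = 1" using w unfolding half_packing_def by simp
  have "(\<Sum>A\<in>K. w A * sg A i) = (\<Sum>A\<in>K. 2 * (w A * of_bool (val A i)) - w A)"
    by (rule sum.cong) auto
  also have "\<dots> = 0" using half one by (simp add: sum_subtractf flip: sum_distrib_left)
  finally show ?thesis .
qed

lemma sum_K_eq_1:
  assumes "half_packing I R w" "\<And>A. w A \<noteq> 0 \<Longrightarrow> A \<in> K"
  shows "(\<Sum>A\<in>K. w A) = 1"
proof -
  have "(\<Sum>A\<in>K. w A) = sum w \<C>" using K_C assms(2) fin\<C> by (intro sum.mono_neutral_left) auto
  then show ?thesis using assms(1) unfolding half_packing_def by simp
qed

text \<open>The barycentric coordinates of the centre of the cube with respect to the core.\<close>

definition lam :: "'a set \<Rightarrow> real" where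
  "lam = (SOME w. half_packing {} V w)"

lemma lam: "half_packing {} V lam"
  unfolding lam_def using A0(1) K_iff by (metis someI_ex)

text \<open>Two packings have the same total and the same mean in every coordinate, so their
  difference is an affine dependence among the core points. Hence any packing constructed below
  agrees with \<open>lam\<close> on the core.\<close>

lemma packing_unique:
  assumes w: "half_packing {} V w" and A: "A \<in> K"
  shows "w A = lam A"
proof -
  have K: "w A \<noteq> 0 \<Longrightarrow> A \<in> K" "lam A \<noteq> 0 \<Longrightarrow> A \<in> K" for A using K_iff w lam by blast+
  have "w A - lam A = 0"
  proof (rule indep_sg[OF _ _ A])
    show "(\<Sum>A\<in>K. w A - lam A) = 0"
      using sum_K_eq_1[OF w K(1)] sum_K_eq_1[OF lam K(2)] by (simp add: sum_subtractf)
    show "(\<Sum>A\<in>K. (w A - lam A) * sg A i) = 0" for i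
      using half_packing_mean[OF w XV K(1), of i] half_packing_mean[OF lam XV K(2), of i]
      by (simp add: sum_subtractf left_diff_distrib)
  qed
  then show ?thesis by simp
qed

lemma lam_pos:
  assumes "A \<in> K"
  shows "0 < lam A"
proof -
  obtain w where "half_packing {} V w" "w A \<noteq> 0" using assms K_iff by blast
  then have "lam A \<noteq> 0" using packing_unique[of w A] assms by simp
  moreover have "0 \<le> lam A" using lam unfolding half_packing_def by blast
  ultimately show ?thesis by simp
qed

section \<open>Moments of the coordinate signs under the distribution \<open>lam\<close>\<close>

definition ex :: "('a set \<Rightarrow> real) \<Rightarrow> real" where
  "ex f = (\<Sum>A\<in>K. lam A * f A)"

lemma ex_add: "ex (\<lambda>A. f A + g A) = ex f + ex g"
  unfolding ex_def by (simp add: distrib_left sum.distrib)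

lemma ex_diff: "ex (\<lambda>A. f A - g A) = ex f - ex g"
  unfolding ex_def by (simp add: right_diff_distrib sum_subtractf)

lemma ex_cmult: "ex (\<lambda>A. c * f A) = c * ex f"
  unfolding ex_def by (simp add: sum_distrib_left mult_ac)

lemma ex_sum: "ex (\<lambda>A. \<Sum>i\<in>S. f i A) = (\<Sum>i\<in>S. ex (f i))"
  unfolding ex_def by (simp add: sum_distrib_left sum.swap[of _ S])

lemma lam_K: "lam A \<noteq> 0 \<Longrightarrow> A \<in> K" using lam K_iff by blast

lemma ex_1: "ex (\<lambda>A. 1) = 1"
  unfolding ex_def using sum_K_eq_1[OF lam lam_K] by simp

lemma ex_const: "ex (\<lambda>A. c) = c"
  using ex_cmult[of c "\<lambda>_. 1"] ex_1 by simp

lemma ex_sg: "ex (\<lambda>A. sg A i) = 0"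
  unfolding ex_def using half_packing_mean[OF lam XV lam_K] .

lemma ex_zero_imp:
  assumes "ex f = 0" "\<And>A. A \<in> K \<Longrightarrow> 0 \<le> f A" "A \<in> K"
  shows "f A = 0"
proof -
  have "\<forall>B\<in>K. 0 \<le> lam B * f B" using lam_pos assms(2) by (simp add: less_imp_le)
  then have "lam A * f A = 0"
    using assms(1,3) finK sum_nonneg_eq_0_iff[of K "\<lambda>B. lam B * f B"] unfolding ex_def by blast
  then show ?thesis using lam_pos[OF assms(3)] by simp
qed

text \<open>The side \<open>X i b\<close> would shrink to one vertex \<open>u\<close> by
  \<open>select_vertex\<close>, making \<open>{u, y}\<close> an edge whose other end lies in the
  opposite side.\<close>

lemma not_cov_X:
  assumes "y \<in> V - X i (\<not> b)"
  shows "\<not> cov (insert y (X i b))"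
proof
  assume "cov (insert y (X i b))"
  then have "\<exists>u\<in>X i b. cov (insert u ({} \<union> {y}))"
  proof (intro select_vertex[of "{}" "{y}" "X i b" "X i (\<not> b)"])
    show "\<not> cov {v}" if "v \<in> X i b \<union> X i (\<not> b)" for v using that XV singles by blast
    show "X i b \<inter> X i (\<not> b) = {}" using X_disj[of _ i b i "\<not> b"] by auto
  qed (use assms XV X_ne conn[of i b] in auto)
  then obtain u where "u \<in> X i b" "cov {u, y}" by auto
  then show False using edges[of u i b y] assms by blast
qed

lemma restricted_packing:
  obtains w where "half_packing (X i b) (V - X i b - X i (\<not> b)) w"
proof -
  have "\<exists>w. half_packing (X i b) (V - X i b - X i (\<not> b)) w"
  proof (rule half_packing_exists)
    obtain v where v: "v \<in> X i b" using X_ne by blast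
    then have "v \<in> V - X i (\<not> b)" using X_disj[of v i b i "\<not> b"] XV by blast
    then show "\<not> cov (X i b)" using not_cov_X[of v i b] v by (simp add: insert_absorb)
    show "\<not> cov (insert y (X i b))" if "y \<in> V - X i b - X i (\<not> b)" for y
      using not_cov_X that by blast
  qed (use XV in blast)+
  then show thesis using that by blast
qed

text \<open>The two packings that fix coordinate \<open>i\<close> average to a packing without
  restriction, which is \<open>lam\<close> by uniqueness. In each of them the sign of
  \<open>i\<close> is constant and the sign of \<open>j\<close> has mean zero.\<close>

lemma ex_sg_sg:
  assumes "i \<noteq> j"
  shows "ex (\<lambda>A. sg A i * sg A j) = 0"
proof -
  have "\<forall>b. \<exists>w. half_packing (X i b) (V - X i b - X i (\<not> b)) w" using restricted_packing by metis
  then obtain w where w: "\<And>b. half_packing (X i b) (V - X i b - X i (\<not> b)) (w b)" by metis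
  have pos: "0 \<le> w b A" and supp: "w b A \<noteq> 0 \<Longrightarrow> A \<in> \<C> \<and> A \<inter> X i b = {}"
    and tot: "sum (w b) \<C> = 1" and load: "v \<in> V - X i b - X i (\<not> b) \<Longrightarrow> sum (w b) {A \<in> \<C>. v \<in> A} \<le> 1 / 2"
    for b A v using w[of b] unfolding half_packing_def by blast+
  have half: "sum (w b) {A \<in> \<C>. v \<in> A} \<le> (if v \<in> X i b then 0 else if v \<in> X i (\<not> b) then 1 else 1 / 2)"
    if "v \<in> V" for b v
  proof -
    have "sum (w b) {A \<in> \<C>. v \<in> A} = 0" if "v \<in> X i b" using supp that by (intro sum.neutral) blast
    moreover have "sum (w b) {A \<in> \<C>. v \<in> A} \<le> sum (w b) \<C>"
      using pos fin\<C> by (intro sum_mono2) auto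
    ultimately show ?thesis using tot[of b] load[of v b] \<open>v \<in> V\<close> by auto
  qed
  define w' where "w' = (\<lambda>A. (w True A + w False A) / 2)"
  have sumw': "sum w' S = (sum (w True) S + sum (w False) S) / 2" for S
    unfolding w'_def by (simp add: sum.distrib sum_divide_distrib[symmetric])
  have w'p: "half_packing {} V w'"
    unfolding half_packing_def
  proof (intro conjI allI impI ballI)
    show "0 \<le> w' A" for A unfolding w'_def using pos by simp
    fix A assume "w' A \<noteq> 0"
    then have "w True A \<noteq> 0 \<or> w False A \<noteq> 0" unfolding w'_def by auto
    then show "A \<in> \<C>" using supp by blast
  next
    show "sum w' \<C> = 1" unfolding sumw' using tot by simp
    fix v assume "v \<in> V"
    then show "sum w' {A \<in> \<C>. v \<in> A} \<le> 1 / 2"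
      using half[of v True] half[of v False] X_disj[of v i True i False] unfolding sumw'
      by (auto split: if_splits)
  qed auto
  \<comment> \<open>Nonnegative weights do not cancel, so the support of each packing lies in the
    support of the average.\<close>
  have K: "A \<in> K" if "w b A \<noteq> 0" for b A
  proof -
    have "w' A \<noteq> 0" using that pos[of True A] pos[of False A] unfolding w'_def by (cases b) auto
    then show ?thesis using w'p K_iff by blast
  qed
  have "(\<Sum>A\<in>K. w b A * (sg A i * sg A j)) = 0" for b
  proof -
    have "w b A * (sg A i * sg A j) = - sgn_of b * (w b A * sg A j)" if "A \<in> K" for A
    proof (cases "w b A = 0")
      case False
      obtain v where v: "v \<in> X i b" using X_ne by blast
      then have "v \<notin> A" using supp[OF False] by blast
      then have "val A i \<noteq> b" using K_mem[OF that v] by blast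
      then show ?thesis by auto
    qed simp
    then have "(\<Sum>A\<in>K. w b A * (sg A i * sg A j)) = - sgn_of b * (\<Sum>A\<in>K. w b A * sg A j)"
      by (simp only: sum_distrib_left cong: sum.cong)
    also have "X j c \<subseteq> V - X i b - X i (\<not> b)" for c
      using XV X_disj[of _ i _ j c] assms by blast
    then have "(\<Sum>A\<in>K. w b A * sg A j) = 0"
      using K by (intro half_packing_mean[OF w[of b]]) blast+
    finally show ?thesis by simp
  qed
  note zero = this
  have "ex (\<lambda>A. sg A i * sg A j) = (\<Sum>A\<in>K. w' A * (sg A i * sg A j))"
    unfolding ex_def using packing_unique[OF w'p] by (intro sum.cong) auto
  also have "\<dots> = ((\<Sum>A\<in>K. w True A * (sg A i * sg A j)) + (\<Sum>A\<in>K. w False A * (sg A i * sg A j))) / 2"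
    unfolding w'_def sum.distrib[symmetric] sum_divide_distrib
    by (rule sum.cong) (auto simp: field_simps)
  also have "\<dots> = 0" using zero by simp
  finally show ?thesis .
qed

lemma ex_sg_sg': "ex (\<lambda>A. sg A i * sg A j) = (if i = j then 1 else 0)"
proof (cases "i = j")
  case True
  then have "ex (\<lambda>A. sg A i * sg A j) = ex (\<lambda>A. 1)" unfolding ex_def by (intro sum.cong) auto
  then show ?thesis using True ex_1 by simp
qed (simp add: ex_sg_sg)

text \<open>The centre of the cube is in the interior of the convex hull of the core, so every transversal
  member can be given a small positive weight.\<close>

lemma transversal_in_K:
  assumes A: "A \<in> \<C>" and s: "\<And>i. side X A i (a i)"
  shows "A \<in> K"
proof -
  define r where "r = real CARD('r)"
  \<comment> \<open>Small enough for \<open>e * h B\<close> not to exceed 1, since the sum in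
    \<open>h\<close> has \<open>r\<close> terms of absolute value 1.\<close>
  define e where "e = 1 / (r + 1)"
  have r0: "0 \<le> r" unfolding r_def by simp
  then have e: "0 < e" "e * (r + 1) = 1" unfolding e_def by simp_all
  \<comment> \<open>The signed weights \<open>lam B * h B\<close> have total 1 and means
    \<open>sgn_of (a i)\<close>, so they represent the cube vertex belonging to \<open>A\<close>.
    Taking \<open>e\<close> times these weights away and giving \<open>A\<close> the weight
    \<open>e\<close> leaves all means at the centre.\<close>
  define h where "h = (\<lambda>B. 1 + (\<Sum>i\<in>UNIV. sgn_of (a i) * sg B i))"
  define w where "w = (\<lambda>B. (if B = A then e else 0) + (if B \<in> K then lam B * (1 - e * h B) else 0))"
  have h_le: "h B \<le> r + 1" for B
  proof -
    have "(\<Sum>i\<in>UNIV. sgn_of (a i) * sg B i) \<le> (\<Sum>i\<in>(UNIV::'r set). 1)"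
      by (rule sum_mono) auto
    then show ?thesis unfolding h_def r_def by simp
  qed
  have h_nonneg: "0 \<le> 1 - e * h B" for B
    using mult_left_mono[OF h_le[of B], of e] e by simp
  have ex_h: "ex h = 1"
    unfolding h_def by (simp add: ex_add ex_const ex_sum ex_cmult ex_sg)
  have ex_h_sg: "ex (\<lambda>B. h B * sg B j) = sgn_of (a j)" for j
  proof -
    have "ex (\<lambda>B. h B * sg B j) = ex (\<lambda>B. sg B j + (\<Sum>i\<in>UNIV. sgn_of (a i) * (sg B i * sg B j)))"
      unfolding h_def by (simp add: distrib_right sum_distrib_right mult.assoc)
    also have "\<dots> = (\<Sum>i\<in>UNIV. sgn_of (a i) * (if i = j then 1 else 0))"
      by (simp only: ex_add ex_sg ex_sum ex_cmult ex_sg_sg' add_0)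
    also have "\<dots> = (\<Sum>i\<in>UNIV. if i = j then sgn_of (a i) else 0)" by (rule sum.cong) auto
    also have "\<dots> = sgn_of (a j)" by simp
    finally show ?thesis .
  qed
  have sum_part: "(\<Sum>B\<in>S. if B \<in> K then lam B * (1 - e * h B) else 0) = (\<Sum>B\<in>K. of_bool (B \<in> S) * (lam B * (1 - e * h B)))"
    if "S \<subseteq> \<C>" for S
  proof -
    have "finite S" using that fin\<C> finite_subset by blast
    then have "(\<Sum>B\<in>S. if B \<in> K then lam B * (1 - e * h B) else 0) = (\<Sum>B\<in>S \<inter> K. lam B * (1 - e * h B))"
      by (simp add: sum.inter_restrict)
    also have "\<dots> = (\<Sum>B\<in>K. of_bool (B \<in> S) * (lam B * (1 - e * h B)))"
      using finK by (intro sum.mono_neutral_cong_left) auto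
    finally show ?thesis .
  qed
  have sum_delta: "(\<Sum>B\<in>S. if B = A then e else 0) = (if A \<in> S then e else 0)" if "S \<subseteq> \<C>" for S
    using that fin\<C> finite_subset[of S \<C>] by simp
  have sum_w: "sum w S = (if A \<in> S then e else 0) + (\<Sum>B\<in>K. of_bool (B \<in> S) * (lam B * (1 - e * h B)))"
    if "S \<subseteq> \<C>" for S
    unfolding w_def sum.distrib sum_part[OF that] sum_delta[OF that] ..
  have "half_packing {} V w"
    unfolding half_packing_def
  proof (intro conjI allI impI ballI)
    show "0 \<le> w B" for B
      unfolding w_def using e h_nonneg lam_pos by (simp add: less_imp_le add_nonneg_nonneg)
    show "B \<in> \<C>" if "w B \<noteq> 0" for B
      using that A K_C unfolding w_def by (auto split: if_splits)
    have "(\<Sum>B\<in>K. of_bool (B \<in> \<C>) * (lam B * (1 - e * h B))) = (\<Sum>B\<in>K. lam B * (1 - e * h B))"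
      using K_C by (intro sum.cong) auto
    also have "\<dots> = ex (\<lambda>B. 1 - e * h B)" unfolding ex_def ..
    also have "\<dots> = 1 - e" by (simp add: ex_diff ex_const ex_cmult ex_h)
    finally show "sum w \<C> = 1" using sum_w[of \<C>] A by simp
    fix v assume "v \<in> V"
    then obtain j b where v: "v \<in> X j b" using X_V by blast
    let ?S = "{B \<in> \<C>. v \<in> B}"
    \<comment> \<open>The factor \<open>(1 + sgn_of b * sg B j) / 2\<close> is the indicator of
      \<open>v \<in> B\<close> on the core.\<close>
    have "of_bool (B \<in> ?S) * (lam B * (1 - e * h B)) = lam B * ((1 - e * h B + sgn_of b * (sg B j - e * (h B * sg B j))) / 2)"
      if "B \<in> K" for B
      using K_mem[OF that v] K_C that by (auto simp: field_simps)
    then have "(\<Sum>B\<in>K. of_bool (B \<in> ?S) * (lam B * (1 - e * h B)))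
        = ex (\<lambda>B. (1 - e * h B + sgn_of b * (sg B j - e * (h B * sg B j))) / 2)"
      unfolding ex_def by (rule sum.cong[OF refl])
    also have "\<dots> = ex (\<lambda>B. (1/2) * (1 - e * h B + sgn_of b * (sg B j - e * (h B * sg B j))))"
      by simp
    also have "\<dots> = (1/2) * (1 - e * 1 + sgn_of b * (0 - e * sgn_of (a j)))"
      by (simp only: ex_cmult ex_add ex_diff ex_const ex_h ex_h_sg ex_sg)
    finally have part: "(\<Sum>B\<in>K. of_bool (B \<in> ?S) * (lam B * (1 - e * h B)))
        = (1/2) * (1 - e * 1 + sgn_of b * (0 - e * sgn_of (a j)))" .
    have "v \<in> A \<longleftrightarrow> a j = b"
      using s[of j] v unfolding side_def by (cases b; cases "a j") auto
    then show "sum w ?S \<le> 1 / 2"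
      using sum_w[of ?S] part A by (cases b; cases "a j") (simp_all add: field_simps)
  qed auto
  moreover have "w A \<noteq> 0"
    using e lam_pos[of A] h_nonneg[of A] unfolding w_def
    by (smt (verit) mult_nonneg_nonneg)
  ultimately show ?thesis using K_iff by blast
qed

text \<open>The product of \<open>1 + sgn_of a * sg B i\<close> and
  \<open>1 + sgn_of b * sg B j\<close> vanishes off the wanted members, and its expectation is 1
  because first and mixed second moments are zero.\<close>

lemma exists_pair:
  assumes "i \<noteq> j"
  shows "\<exists>B\<in>K. val B i = a \<and> val B j = b"
proof (rule ccontr)
  assume no: "\<not> ?thesis"
  have "1 = ex (\<lambda>B. 1 + sgn_of a * sg B i + sgn_of b * sg B j + (sgn_of a * sgn_of b) * (sg B i * sg B j))"
    using ex_sg_sg[OF assms] by (simp only: ex_add ex_cmult ex_const ex_sg)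
  also have "\<dots> = ex (\<lambda>B. 0)"
    unfolding ex_def using no by (intro sum.cong) auto
  finally show False by (simp add: ex_const)
qed

lemma val_inject:
  assumes "\<And>B. B \<in> K \<Longrightarrow> val B i = val B j"
  shows "i = j"
  using exists_pair[of i j True False] assms by blast

text \<open>The product of the three factors \<open>1 + sgn_of a * sg B i\<close> and so on vanishes
  on the core. Only its constant and its triple product contribute to the expectation, so
  \<open>1 + ?s * ?p B\<close> has expectation zero; being nonnegative, it vanishes on every core
  member. Its value at \<open>A0\<close>, where all signs are -1, determines
  \<open>c\<close>.\<close>

lemma triple_relation:
  assumes d: "i \<noteq> j" "i \<noteq> l" "j \<noteq> l"
    and no: "\<And>B. B \<in> K \<Longrightarrow> val B i = a \<Longrightarrow> val B j = b \<Longrightarrow> val B l \<noteq> c"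
  shows "c = (a = b)" "B \<in> K \<Longrightarrow> val B l = (val B i \<noteq> val B j)"
proof -
  let ?p = "\<lambda>B. sg B i * (sg B j * sg B l)"
  let ?s = "sgn_of a * (sgn_of b * sgn_of c)"
  have "0 = ex (\<lambda>B. 0)" by (simp add: ex_const)
  also have "\<dots> = ex (\<lambda>B. (1 + sgn_of a * sg B i + sgn_of b * sg B j + sgn_of c * sg B l
      + (sgn_of a * sgn_of b) * (sg B i * sg B j) + (sgn_of a * sgn_of c) * (sg B i * sg B l)
      + (sgn_of b * sgn_of c) * (sg B j * sg B l)) + ?s * ?p B)"
    unfolding ex_def using no by (intro sum.cong) auto
  also have "\<dots> = 1 + ?s * ex ?p"
    using ex_sg_sg[OF d(1)] ex_sg_sg[OF d(2)] ex_sg_sg[OF d(3)]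
    by (simp only: ex_add ex_cmult ex_const ex_sg)
  also have "\<dots> = ex (\<lambda>B. 1 + ?s * ?p B)"
    by (simp only: ex_add ex_cmult ex_const)
  finally have "ex (\<lambda>B. 1 + ?s * ?p B) = 0" by simp
  then have eq: "1 + ?s * ?p B = 0" if "B \<in> K" for B
  proof (rule ex_zero_imp[of "\<lambda>B. 1 + ?s * ?p B", OF _ _ that])
    show "0 \<le> 1 + ?s * ?p A" for A by auto
  qed
  show c: "c = (a = b)"
    using eq[OF A0(1)] A0_val by (auto split: if_splits)
  show "val B l = (val B i \<noteq> val B j)" if "B \<in> K"
    using eq[OF that] c by (auto split: if_splits)
qed

text \<open>Without such a cover there is a packing avoiding both sides. Its barycentric coordinates are then
  forced to be negative on the core members that contain both sides.\<close>

lemma third_cover: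
  assumes "i \<noteq> j"
  shows "\<exists>l. l \<noteq> i \<and> l \<noteq> j \<and> (\<forall>B\<in>K. val B l = (val B i \<noteq> val B j)) \<and>
    cov (X i a \<union> X j b \<union> X l (a \<noteq> b))"
proof -
  let ?I = "X i a \<union> X j b"
  define R where "R = V - (X i True \<union> X i False \<union> X j True \<union> X j False)"
  have "\<exists>y\<in>R. cov (insert y ?I)"
  proof (rule ccontr)
    assume no: "\<not> ?thesis"
    have "\<exists>w. half_packing ?I R w"
    proof (rule half_packing_exists)
      show "?I \<subseteq> V" "R \<subseteq> V" using XV unfolding R_def by blast+
      show "?I \<inter> R = {}" unfolding R_def by (cases a; cases b) auto
      obtain B where B: "B \<in> K" "val B i = (\<not> a)" "val B j = (\<not> b)" using exists_pair[OF assms] by blast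
      have "?I \<inter> B = {}"
        using K_mem[OF B(1), of _ i a] K_mem[OF B(1), of _ j b] B(2,3) by blast
      then show "\<not> cov ?I" using B(1) K_C unfolding hits_def by blast
    qed (use no in blast)
    then obtain w where w: "half_packing ?I R w" by blast
    have supp: "A \<in> \<C>" "A \<inter> ?I = {}" if "w A \<noteq> 0" for A
      using w that unfolding half_packing_def by blast+
    have XR: "X l c \<subseteq> R" if "l \<noteq> i" "l \<noteq> j" for l c
      using that XV X_disj[of _ l c] unfolding R_def by blast
    have avoid: "side X A k (\<not> c)" if "w A \<noteq> 0" "A \<inter> X k c = {}" for A k c
    proof -
      have "x \<in> A" if x: "x \<in> X k (\<not> c)" for x
      proof -
        obtain y where "y \<in> X k c" "cov {y, x}" using nbr'[OF x] by blast
        then show ?thesis using \<open>A \<inter> X k c = {}\<close> supp(1)[OF \<open>w A \<noteq> 0\<close>] unfolding hits_def by blast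
      qed
      then show ?thesis using that(2) unfolding side_def by auto
    qed
    have si: "side X A i (\<not> a)" "side X A j (\<not> b)" if "w A \<noteq> 0" for A
      using avoid[OF that] supp(2)[OF that] by blast+
    \<comment> \<open>The support is transversal: at \<open>i\<close> and \<open>j\<close> its
      members avoid one side, and every other component lies in \<open>R\<close> and is split by the
      packing.\<close>
    have K: "A \<in> K" if "w A \<noteq> 0" for A
    proof (rule transversal_in_K)
      show "A \<in> \<C>" using supp that by blast
      show "side X A l (if l = i then \<not> a else if l = j then \<not> b else val A l)" for l
        using si[OF that] half_packing_X[OF w that XR] by auto
    qed
    have mean: "(\<Sum>A\<in>K. w A * sg A l) = (if l = i then - sgn_of a else if l = j then - sgn_of b else 0)" for l
    proof -
      have "(\<Sum>A\<in>K. w A * sg A i) = (\<Sum>A\<in>K. - sgn_of a * w A)"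
      proof (rule sum.cong)
        show "w A * sg A i = - sgn_of a * w A" for A
          using side_val[OF si(1), of A] by (cases "w A = 0") auto
      qed simp
      then have i: "(\<Sum>A\<in>K. w A * sg A i) = - sgn_of a"
        using sum_K_eq_1[OF w K] by (simp add: sum_negf)
      have "(\<Sum>A\<in>K. w A * sg A j) = (\<Sum>A\<in>K. - sgn_of b * w A)"
      proof (rule sum.cong)
        show "w A * sg A j = - sgn_of b * w A" for A
          using side_val[OF si(2), of A] by (cases "w A = 0") auto
      qed simp
      then have j: "(\<Sum>A\<in>K. w A * sg A j) = - sgn_of b"
        using sum_K_eq_1[OF w K] by (simp add: sum_negf)
      show ?thesis using i j half_packing_mean[OF w XR K, of l] by auto
    qed
    \<comment> \<open>Relative to \<open>lam\<close>, the function with total 1 and means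
      \<open>- sgn_of a\<close> at \<open>i\<close>, \<open>- sgn_of b\<close> at \<open>j\<close>
      and 0 elsewhere, exactly as for \<open>w\<close>. Affine independence yields
      \<open>w A = lam A * ?g A\<close>, and \<open>?g\<close> is -1 where the bits are
      \<open>a\<close> and \<open>b\<close>.\<close>
    let ?g = "\<lambda>A. 1 - sgn_of a * sg A i - sgn_of b * sg A j"
    have eq: "w A - lam A * ?g A = 0" if "A \<in> K" for A
    proof (rule indep_sg[OF _ _ that])
      have "ex ?g = 1" by (simp only: ex_diff ex_const ex_cmult ex_sg mult_zero_right diff_zero)
      then show "(\<Sum>A\<in>K. w A - lam A * ?g A) = 0"
        unfolding sum_subtractf using sum_K_eq_1[OF w K] unfolding ex_def by linarith
      fix l
      have "ex (\<lambda>A. ?g A * sg A l) = ex (\<lambda>A. sg A l - sgn_of a * (sg A i * sg A l) - sgn_of b * (sg A j * sg A l))"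
        by (simp only: left_diff_distrib mult.assoc mult_1_left)
      also have "\<dots> = (if l = i then - sgn_of a else if l = j then - sgn_of b else 0)"
        by (simp only: ex_diff ex_cmult ex_sg ex_sg_sg') (simp add: assms assms[symmetric])
      finally show "(\<Sum>A\<in>K. (w A - lam A * ?g A) * sg A l) = 0"
        unfolding ex_def using mean[of l] by (simp only: left_diff_distrib sum_subtractf mult.assoc)
    qed
    obtain B where B: "B \<in> K" "val B i = a" "val B j = b" using exists_pair[OF assms] by blast
    have "w B = - lam B" using eq[OF B(1)] B by auto
    then show False using lam_pos[OF B(1)] w unfolding half_packing_def by (metis neg_less_0_iff_less not_less)
  qed
  then obtain y where y: "y \<in> R" "cov (insert y ?I)" by blast
  then obtain l c where l: "y \<in> X l c" using X_V unfolding R_def by blast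
  then have d: "l \<noteq> i" "l \<noteq> j" using y(1) unfolding R_def by (cases c, auto)+
  \<comment> \<open>Every core member meets the cover found, so one of the eight patterns on
    \<open>i\<close>, \<open>j\<close>, \<open>l\<close> is missing.\<close>
  have no: "val B l \<noteq> (\<not> c)" if B: "B \<in> K" "val B i = (\<not> a)" "val B j = (\<not> b)" for B
  proof
    assume "val B l = (\<not> c)"
    then have "insert y ?I \<inter> B = {}"
      using K_mem[OF B(1), of _ i a] K_mem[OF B(1), of _ j b] K_mem[OF B(1) l] B(2,3) by blast
    then show False using y(2) B(1) K_C unfolding hits_def by blast
  qed
  note rel = triple_relation[OF assms d[symmetric] no]
  have "c = (a \<noteq> b)" using rel(1) by blast
  then have "insert y ?I \<subseteq> X i a \<union> X j b \<union> X l (a \<noteq> b)" using l by blast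
  then have "cov (X i a \<union> X j b \<union> X l (a \<noteq> b))" using y(2) hits_mono by blast
  then show ?thesis using d rel(2) by blast
qed

section \<open>The third point on the line through two coordinates\<close>

definition third :: "'r \<Rightarrow> 'r \<Rightarrow> 'r" where
  "third i j = (SOME l. \<forall>B\<in>K. val B l = (val B i \<noteq> val B j))"

lemma third_unique:
  assumes "\<And>B. B \<in> K \<Longrightarrow> val B l = (val B i \<noteq> val B j)"
  shows "third i j = l"
proof (rule val_inject)
  have "\<forall>B\<in>K. val B (third i j) = (val B i \<noteq> val B j)"
    unfolding third_def by (rule someI[of _ l]) (use assms in blast)
  then show "val B (third i j) = val B l" if "B \<in> K" for B using assms that by blast
qed

text \<open>For each choice of sides \<open>third_cover\<close> yields some coordinate;
  \<open>third_unique\<close> shows that it is always the same one.\<close>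

lemma third:
  assumes "i \<noteq> j"
  shows "third i j \<noteq> i" "third i j \<noteq> j" "B \<in> K \<Longrightarrow> val B (third i j) = (val B i \<noteq> val B j)"
    "cov (X i a \<union> X j b \<union> X (third i j) (a \<noteq> b))"
proof -
  have "\<exists>l. l = third i j \<and> l \<noteq> i \<and> l \<noteq> j \<and> (\<forall>B\<in>K. val B l = (val B i \<noteq> val B j)) \<and>
    cov (X i a \<union> X j b \<union> X l (a \<noteq> b))" for a b
    using third_cover[OF assms, of a b] third_unique by metis
  then show "third i j \<noteq> i" "third i j \<noteq> j" "B \<in> K \<Longrightarrow> val B (third i j) = (val B i \<noteq> val B j)"
    "cov (X i a \<union> X j b \<union> X (third i j) (a \<noteq> b))" by metis+
qed

end

section \<open>Shrinking components to edges\<close>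

lemma exists_not_in:
  fixes S :: "'r::finite set"
  assumes "card S < CARD('r)"
  shows "\<exists>j. j \<notin> S"
  using assms by (metis UNIV_eq_I less_irrefl)

context simplex_core
begin

lemma third_commute: "i \<noteq> j \<Longrightarrow> third i j = third j i"
  using third(3)[of j i] by (intro third_unique) auto

lemma third_third: "i \<noteq> j \<Longrightarrow> third i (third i j) = j"
  using third(3)[of i j] by (intro third_unique) auto

lemma third_associate:
  assumes "i \<noteq> j" "i \<noteq> m" "third i j \<noteq> m"
  shows "third j (third i m) = third (third i j) m"
  using third(3)[OF assms(1)] third(3)[OF assms(2)] third(3)[OF assms(3)]
  by (intro third_unique) auto

text \<open>Shrinking the components of a frame one at a time to single edges finally leaves one vertex per
  side, so that the covers along the lines become consistent three-element sets.\<close>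

definition frame :: "('r \<Rightarrow> bool \<Rightarrow> 'a set) \<Rightarrow> bool" where
  "frame Y \<longleftrightarrow>
     (\<forall>i b. Y i b \<subseteq> X i b \<and> Y i b \<noteq> {} \<and> alt_conn {} (Y i b) (Y i (\<not> b)) \<and>
        (\<forall>x\<in>Y i b. \<exists>y\<in>Y i (\<not> b). cov {x, y})) \<and>
     (\<forall>i j a b. i \<noteq> j \<longrightarrow> cov (Y i a \<union> Y j b \<union> Y (third i j) (a \<noteq> b)))"

lemma frame_X: "frame X"
  unfolding frame_def using X_ne conn nbr third(4) by blast

lemma K_avoid:
  assumes "B \<in> K" "val B i = (\<not> a)" "Z \<subseteq> X i a"
  shows "Z \<inter> B = {}"
  using K_mem[OF assms(1), of _ i a] assms(2,3) by blast

lemma not_cov_if_K: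
  assumes "B \<in> K" "Z \<inter> B = {}"
  shows "\<not> cov Z"
  using assms K_C unfolding hits_def by blast

text \<open>A missing pattern would make \<open>m\<close> the third point on the line of
  \<open>i\<close> and \<open>j\<close>.\<close>

lemma exists_triple:
  assumes "i \<noteq> j" "m \<noteq> i" "m \<noteq> j" "m \<noteq> third i j"
  shows "\<exists>B\<in>K. val B i = a \<and> val B j = b \<and> val B m = c"
proof (rule ccontr)
  assume "\<not> ?thesis"
  then have no: "\<And>B. B \<in> K \<Longrightarrow> val B i = a \<Longrightarrow> val B j = b \<Longrightarrow> val B m \<noteq> c" by blast
  have "third i j = m"
    using triple_relation(2)[OF assms(1) assms(2,3)[symmetric] no] by (rule third_unique)
  then show False using assms(4) by simp
qed

context
  fixes Y :: "'r \<Rightarrow> bool \<Rightarrow> 'a set"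
  assumes Y: "frame Y"
begin

lemma frame_sub: "Y i b \<subseteq> X i b"
  and frame_ne: "Y i b \<noteq> {}"
  and frame_conn: "alt_conn {} (Y i b) (Y i (\<not> b))"
  and frame_nbr: "x \<in> Y i b \<Longrightarrow> \<exists>y\<in>Y i (\<not> b). cov {x, y}"
  and frame_line: "i \<noteq> j \<Longrightarrow> cov (Y i a \<union> Y j b \<union> Y (third i j) (a \<noteq> b))"
  using Y unfolding frame_def by blast+

lemma frame_V: "Y i b \<subseteq> V"
  using frame_sub XV by blast

lemma frame_disj: "i \<noteq> j \<or> a \<noteq> b \<Longrightarrow> Y i a \<inter> Y j b = {}"
  using frame_sub X_disj by blast

lemma frame_nbr': "y \<in> Y i (\<not> a) \<Longrightarrow> \<exists>x\<in>Y i a. cov {x, y}"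
  using frame_nbr[of y i "\<not> a"] by (auto simp: insert_commute)

lemma frame_select:
  assumes "T \<subseteq> V" "T \<inter> Y j (\<not> b) = {}" "cov (T \<union> Y j b)"
  shows "\<exists>y\<in>Y j b. cov (insert y T)"
proof -
  have "\<exists>y\<in>Y j b. cov (insert y ({} \<union> T))"
  proof (rule select_vertex)
    show "\<not> cov {v}" if "v \<in> Y j b \<union> Y j (\<not> b)" for v using that frame_V singles by blast
    show "Y j b \<inter> Y j (\<not> b) = {}" using frame_disj by simp
  qed (use assms frame_V frame_conn frame_ne in auto)
  then show ?thesis by simp
qed

lemma frame_half_packing_side:
  assumes "half_packing I R w" "w A \<noteq> 0" "\<And>b. Y i b \<subseteq> R"
  obtains b where "side Y A i b"
proof -
  have "Y i True \<subseteq> A \<and> Y i False \<inter> A = {} \<or> Y i False \<subseteq> A \<and> Y i True \<inter> A = {}"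
    using half_packing_side[OF assms(1,2,3,3)] frame_conn[of i True] frame_nbr[of _ i True]
      frame_nbr'[of _ i True] by simp
  then have "side Y A i True \<or> side Y A i False" unfolding side_def by auto
  then show thesis using that by blast
qed

lemma frame_half_packing_avoiding:
  assumes w: "half_packing I R w" and R: "\<And>b. Y i b \<subseteq> R" and v: "v \<in> Y i b"
  obtains A where "w A \<noteq> 0" "v \<notin> A"
proof -
  obtain y where y: "y \<in> Y i (\<not> b)" "cov {v, y}" using frame_nbr[OF v] by blast
  then have "cov (I \<union> {v, y})" using hits_mono by blast
  then have half: "sum w {A \<in> \<C>. v \<in> A} = 1 / 2" using half_packing_edge(1)[OF w] y(1) v R by blast
  have "\<exists>A. w A \<noteq> 0 \<and> v \<notin> A"
  proof (rule ccontr)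
    assume "\<not> ?thesis"
    then have "sum w {A \<in> \<C>. v \<in> A} = sum w \<C>" using fin\<C> by (intro sum.mono_neutral_left) auto
    then show False using half w unfolding half_packing_def by simp
  qed
  then show thesis using that by blast
qed

lemma side_mem: "side Y A i b \<Longrightarrow> v \<in> Y i c \<Longrightarrow> v \<in> A \<longleftrightarrow> b = c"
  unfolding side_def by (cases b; cases c) auto

lemma side_if_avoid:
  assumes "A \<in> \<C>" "Y i (\<not> b) \<inter> A = {}"
  shows "side Y A i b"
proof -
  have "x \<in> A" if "x \<in> Y i b" for x
  proof -
    obtain y where "y \<in> Y i (\<not> b)" "cov {x, y}" using frame_nbr \<open>x \<in> Y i b\<close> by blast
    then show ?thesis using assms unfolding hits_def by blast
  qed
  then show ?thesis using assms(2) unfolding side_def by blast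
qed

text \<open>\<open>A\<close> misses the opposite sides at \<open>i\<close> and \<open>j\<close>, so
  it must meet the line cover formed by opposite sides in the third component. This extends the
  relation between the bits of core members to all members that the three components split.\<close>

lemma frame_parity:
  assumes A: "A \<in> \<C>" and "i \<noteq> j" and s: "side Y A i p" "side Y A j q" "side Y A (third i j) r"
  shows "r = (p \<noteq> q)"
proof -
  have "cov (Y i (\<not> p) \<union> Y j (\<not> q) \<union> Y (third i j) ((\<not> p) \<noteq> (\<not> q)))" using frame_line[OF \<open>i \<noteq> j\<close>] .
  then have "(Y i (\<not> p) \<union> Y j (\<not> q) \<union> Y (third i j) ((\<not> p) \<noteq> (\<not> q))) \<inter> A \<noteq> {}"
    using A unfolding hits_def by blast
  moreover have "Y i (\<not> p) \<inter> A = {}" "Y j (\<not> q) \<inter> A = {}" using s(1,2) unfolding side_def by auto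
  ultimately have "Y (third i j) ((\<not> p) \<noteq> (\<not> q)) \<inter> A \<noteq> {}" by (simp add: Int_Un_distrib2)
  then obtain v where "v \<in> Y (third i j) ((\<not> p) \<noteq> (\<not> q))" "v \<in> A" by blast
  then show ?thesis using side_mem[OF s(3)] by blast
qed

text \<open>If the new set is no cover, delete \<open>u\<close> and \<open>Y m d\<close> and keep
  only the components other than \<open>i\<close> and \<open>m\<close>. By
  \<open>triple_relation\<close> a singleton cover could only come from
  \<open>Y n (a \<noteq> d)\<close>, which the assumption excludes, so a packing exists. Take a
  member \<open>A\<close> of its support omitting a vertex \<open>v\<close> of that side. The bits
  of \<open>A\<close> at \<open>m\<close> and \<open>n\<close> are then known, and the two lines
  through \<open>t\<close> give \<open>pj \<noteq> pk\<close> exactly when \<open>a\<close> holds,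
  whereas the relative pair cover \<open>{y, z}\<close> gives the contrary.\<close>

lemma spread:
  assumes u: "u \<in> Y i a" and ij: "i \<noteq> j" and yz: "y \<in> Y j b" "z \<in> Y (third i j) (a \<noteq> b)"
    and c: "cov {u, y, z}" and m: "m \<noteq> i" "m \<noteq> j" "m \<noteq> third i j"
  shows "cov ({u} \<union> Y m d \<union> Y (third i m) (a \<noteq> d))"
proof (rule ccontr)
  assume no: "\<not> ?thesis"
  \<comment> \<open>In additive notation \<open>k = i + j\<close>, \<open>n = i + m\<close>,
    \<open>s = j + m\<close> and \<open>t = i + j + m\<close>.\<close>
  define k where "k = third i j"
  define n where "n = third i m"
  define s where "s = third j m"
  define t where "t = third k m"
  note kd = third(1,2)[OF ij, folded k_def]
  note nd = third(1,2)[OF m(1)[symmetric], folded n_def]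
  note sd = third(1,2)[OF m(2)[symmetric], folded s_def]
  have km: "k \<noteq> m" using m(3) k_def by simp
  note td = third(1,2)[OF km, folded t_def]
  have nj: "n \<noteq> j" using third_third[OF m(1)[symmetric]] m(3) unfolding n_def by auto
  have nk: "n \<noteq> k" using third_third[OF m(1)[symmetric]] third_third[OF ij] m(2) unfolding n_def k_def by auto
  have si: "s \<noteq> i"
    using third_third[OF m(2)[symmetric]] third_commute[OF ij] m(3) unfolding s_def by auto
  have ti: "t \<noteq> i"
    using third_third[OF km] third_commute[OF kd(1)] third_third[OF ij] m(2) unfolding t_def k_def by auto
  have t_alt: "t = third j n"
    unfolding t_def k_def n_def using third_associate[OF ij m(1)[symmetric]] m(3) by simp
  have tm: "t \<noteq> m" by (rule td(2))
  have sm: "s \<noteq> m" by (rule sd(2))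
  define I where "I = insert u (Y m d)"
  define R where "R = (\<Union>l\<in>-{i, m}. Y l True \<union> Y l False)"
  have YR: "Y l c \<subseteq> R" if "l \<noteq> i" "l \<noteq> m" for l c using that unfolding R_def by (cases c) auto
  have "\<exists>w. half_packing I R w"
  proof (rule half_packing_exists)
    show "I \<subseteq> V" "R \<subseteq> V" using u frame_V unfolding I_def R_def by blast+
    show "I \<inter> R = {}" using u frame_disj unfolding I_def R_def by blast
    obtain B where B: "B \<in> K" "val B i = (\<not> a)" "val B m = (\<not> d)"
      using exists_pair[OF m(1)[symmetric]] by blast
    have "I \<inter> B = {}"
      using K_avoid[OF B(1,2), of "{u}"] K_avoid[OF B(1,3) frame_sub] u frame_sub unfolding I_def by auto
    then show "\<not> cov I" using not_cov_if_K B(1) by blast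
    show "\<not> cov (insert v I)" if v: "v \<in> R" for v
    proof
      assume cv: "cov (insert v I)"
      obtain l e where l: "l \<noteq> i" "l \<noteq> m" "v \<in> Y l e" using v unfolding R_def by blast
      have no_B: "val B l \<noteq> (\<not> e)" if B: "B \<in> K" "val B i = (\<not> a)" "val B m = (\<not> d)" for B
      proof
        assume e: "val B l = (\<not> e)"
        have "insert v I \<inter> B = {}"
          using K_avoid[OF B(1,2), of "{u}"] K_avoid[OF B(1,3) frame_sub] K_avoid[OF B(1) e, of "{v}"]
            u l(3) frame_sub unfolding I_def by auto
        then show False using not_cov_if_K B(1) cv by blast
      qed
      have "(\<not> e) = ((\<not> a) = (\<not> d))"
        by (rule triple_relation(1)[OF m(1)[symmetric] l(1,2)[symmetric]]) (rule no_B)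
      then have "e = (a \<noteq> d)" by blast
      moreover have "val B l = (val B i \<noteq> val B m)" if "B \<in> K" for B
        by (rule triple_relation(2)[OF m(1)[symmetric] l(1,2)[symmetric] _ that]) (rule no_B)
      then have "l = n" unfolding n_def by (rule third_unique[symmetric])
      ultimately have "insert v I \<subseteq> {u} \<union> Y m d \<union> Y (third i m) (a \<noteq> d)"
        using l(3) unfolding I_def n_def by auto
      then show False using no cv hits_mono by blast
    qed
  qed
  then obtain w where w: "half_packing I R w" by blast
  obtain v where v: "v \<in> Y n (a \<noteq> d)" using frame_ne by blast
  obtain A where A: "w A \<noteq> 0" "v \<notin> A"
    using frame_half_packing_avoiding[OF w YR v] nd by blast
  have AC: "A \<in> \<C>" "A \<inter> I = {}" using w A(1) unfolding half_packing_def by blast+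
  have side_ex: "\<exists>b. side Y A l b" if "l \<noteq> i" "l \<noteq> m" for l
    using frame_half_packing_side[OF w A(1) YR] that by metis
  have sides: "\<exists>b. side Y A n b" "\<exists>b. side Y A j b" "\<exists>b. side Y A k b" "\<exists>b. side Y A s b" "\<exists>b. side Y A t b"
    using side_ex nd kd ij m km si sm ti tm by auto
  obtain pn pj pk ps pt where p: "side Y A n pn" "side Y A j pj" "side Y A k pk" "side Y A s ps" "side Y A t pt"
    using sides by blast
  have pm: "side Y A m (\<not> d)"
    using AC unfolding I_def by (intro side_if_avoid) auto
  have pn: "pn = (\<not> (a \<noteq> d))" using side_mem[OF p(1) v] A(2) by blast
  have e1: "ps = (pj \<noteq> (\<not> d))" using frame_parity[OF AC(1) m(2)[symmetric] p(2) pm] p(4) unfolding s_def by blast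
  have e2: "pt = (pk \<noteq> (\<not> d))" using frame_parity[OF AC(1) km p(3) pm] p(5) unfolding t_def by blast
  have e3: "pt = (pj \<noteq> pn)" using frame_parity[OF AC(1) nj[symmetric] p(2) p(1)] p(5) unfolding t_alt by blast
  have "cov (I \<union> {y, z})" using c by (rule hits_mono) (auto simp: I_def)
  moreover have "y \<in> R" using YR[OF ij[symmetric] m(2)[symmetric]] yz(1) by (rule subsetD)
  moreover have "z \<in> R" using YR[OF kd(1) km] yz(2)[folded k_def] by (rule subsetD)
  ultimately have "y \<in> A \<longleftrightarrow> z \<notin> A" using half_packing_edge(3)[OF w _ _ _ A(1)] by blast
  moreover have "y \<in> A \<longleftrightarrow> pj = b" by (rule side_mem[OF p(2) yz(1)])
  moreover have "z \<in> A \<longleftrightarrow> pk = (a \<noteq> b)" by (rule side_mem[OF p(3) yz(2)[folded k_def]])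
  ultimately have e4: "(pj = b) \<noteq> (pk = (a \<noteq> b))" by simp
  show False using e2 e3 e4 pn by (cases a; cases b; cases d; cases pj; cases pk) auto
qed

text \<open>The condition under which \<open>u\<close> can replace \<open>Y i a\<close> in all lines
  through \<open>i\<close> at once.\<close>

definition good :: "'r \<Rightarrow> bool \<Rightarrow> 'a \<Rightarrow> bool" where
  "good i a u \<longleftrightarrow> (\<forall>m d. m \<noteq> i \<longrightarrow> cov ({u} \<union> Y m d \<union> Y (third i m) (a \<noteq> d)))"

text \<open>\<open>frame_select\<close> shrinks the two sides one after the other; what is not being
  shrunk serves as the fixed part of the cover.\<close>

lemma line_triple:
  assumes u: "u \<in> Y i a" and ij: "i \<noteq> j" and c: "cov ({u} \<union> Y j b \<union> Y (third i j) e)"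
  shows "\<exists>y\<in>Y j b. \<exists>z\<in>Y (third i j) e. cov {u, y, z}"
proof -
  let ?k = "third i j"
  have k: "?k \<noteq> i" "?k \<noteq> j" using third(1,2)[OF ij] by auto
  have "\<exists>y\<in>Y j b. cov (insert y (insert u (Y ?k e)))"
  proof (rule frame_select)
    show "insert u (Y ?k e) \<subseteq> V" using u frame_V by blast
    show "insert u (Y ?k e) \<inter> Y j (\<not> b) = {}"
      using u frame_disj[of i j a "\<not> b"] frame_disj[of ?k j e "\<not> b"] ij k by blast
    show "cov (insert u (Y ?k e) \<union> Y j b)" using c by (rule hits_mono) auto
  qed
  then obtain y where y: "y \<in> Y j b" "cov (insert y (insert u (Y ?k e)))" by blast
  have "\<exists>z\<in>Y ?k e. cov (insert z {u, y})"
  proof (rule frame_select)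
    show "{u, y} \<subseteq> V" using u y frame_V by blast
    show "{u, y} \<inter> Y ?k (\<not> e) = {}"
      using u y(1) frame_disj[of i ?k a "\<not> e"] frame_disj[of j ?k b "\<not> e"] k[symmetric] by auto
    show "cov ({u, y} \<union> Y ?k e)" using y(2) by (rule hits_mono) auto
  qed
  then obtain z where "z \<in> Y ?k e" "cov (insert z {u, y})" by blast
  moreover have "insert z {u, y} = {u, y, z}" by auto
  ultimately show ?thesis using y(1) by auto
qed

text \<open>A vertex \<open>u\<close> is selected for a single cover on one line through
  \<open>i\<close>. Then \<open>spread\<close> carries it to both signs on every other line through
  \<open>i\<close>, and the remaining covers on the first line are reached by spreading back from
  the line through \<open>m0\<close>, a coordinate off the first line.\<close>

lemma exists_good:
  assumes card: "4 \<le> CARD('r)"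
  shows "\<exists>u\<in>Y i a. good i a u"
proof -
  have fresh: "\<exists>j. j \<notin> S" if "card S < 4" for S :: "'r set"
    using exists_not_in that card by (meson less_le_trans)
  have "\<exists>j. j \<notin> {i}" by (rule fresh) simp
  then obtain j where "j \<notin> {i}" by blast
  then have ij: "i \<noteq> j" by auto
  let ?k = "third i j"
  have k: "?k \<noteq> i" "?k \<noteq> j" using third(1,2)[OF ij] by auto
  have "card {i, j, ?k} < 4" using ij k by simp
  then obtain m0 where m0: "m0 \<noteq> i" "m0 \<noteq> j" "m0 \<noteq> ?k" using fresh by blast
  have "\<exists>u\<in>Y i a. cov (insert u (Y j True \<union> Y ?k (a \<noteq> True)))"
  proof (rule frame_select)
    show "Y j True \<union> Y ?k (a \<noteq> True) \<subseteq> V" using frame_V by blast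
    show "(Y j True \<union> Y ?k (a \<noteq> True)) \<inter> Y i (\<not> a) = {}"
      using frame_disj[of j i True "\<not> a"] frame_disj[of ?k i "a \<noteq> True" "\<not> a"] ij k by blast
    show "cov (Y j True \<union> Y ?k (a \<noteq> True) \<union> Y i a)"
      using frame_line[OF ij, of a True] by (rule hits_mono) auto
  qed
  then obtain u where u: "u \<in> Y i a" and c: "cov (insert u (Y j True \<union> Y ?k (a \<noteq> True)))" by blast
  have spread_line: "cov ({u} \<union> Y m d \<union> Y (third i m) (a \<noteq> d))"
    if l: "l \<noteq> i" "cov ({u} \<union> Y l e \<union> Y (third i l) (a \<noteq> e))" and m: "m \<noteq> i" "m \<noteq> l" "m \<noteq> third i l" for l e m d
  proof -
    obtain y z where "y \<in> Y l e" "z \<in> Y (third i l) (a \<noteq> e)" "cov {u, y, z}"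
      using line_triple[OF u l(1)[symmetric] l(2)] by blast
    then show ?thesis using spread[OF u l(1)[symmetric]] m by blast
  qed
  have cj: "cov ({u} \<union> Y j True \<union> Y ?k (a \<noteq> True))" using c by simp
  have c0: "cov ({u} \<union> Y m0 True \<union> Y (third i m0) (a \<noteq> True))"
    using spread_line[OF ij[symmetric] cj m0] .
  have ne: "j \<noteq> third i m0" "?k \<noteq> third i m0"
    using third_third[OF m0(1)[symmetric]] third_third[OF ij] m0 by auto
  have "good i a u"
    unfolding good_def
  proof (intro allI impI)
    fix m d assume m: "m \<noteq> i"
    show "cov ({u} \<union> Y m d \<union> Y (third i m) (a \<noteq> d))"
    proof (cases "m = j \<or> m = ?k")
      case True
      then have "m \<noteq> m0" "m \<noteq> third i m0" using m0 ne by auto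
      then show ?thesis using spread_line[OF m0(1) c0 m] by blast
    next
      case False
      then show ?thesis using spread_line[OF ij[symmetric] cj m] by blast
    qed
  qed
  then show ?thesis using u by blast
qed

text \<open>Otherwise delete \<open>u\<close> but keep \<open>w\<close> together with a neighbour
  \<open>v\<close>. The edge \<open>{v, w}\<close> keeps the load of \<open>w\<close> at 1/2, so
  some \<open>A\<close> in the support omits both \<open>u\<close> and \<open>w\<close>. A line
  triple of \<open>u\<close> forces different bits of \<open>A\<close> at \<open>j\<close> and
  \<open>third i j\<close>, while a line cover through \<open>w\<close> forces equal ones.\<close>

lemma good_adjacent:
  assumes u: "u \<in> Y i False" "good i False u" and w: "w \<in> Y i True" "good i True w"
    and ij: "i \<noteq> j"
  shows "cov {u, w}"
proof (rule ccontr)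
  assume no: "\<not> ?thesis"
  let ?k = "third i j"
  have k: "?k \<noteq> i" "?k \<noteq> j" using third(1,2)[OF ij] by auto
  obtain v where v: "v \<in> Y i False" "cov {v, w}" using frame_nbr'[of w i False] w(1) by auto
  define R where "R = {v, w} \<union> (\<Union>l\<in>-{i}. Y l True \<union> Y l False)"
  have YR: "Y l c \<subseteq> R" if "l \<noteq> i" for l c using that unfolding R_def by (cases c) auto
  have "\<exists>w. half_packing {u} R w"
  proof (rule half_packing_exists)
    show uV: "{u} \<subseteq> V" using u frame_V by blast
    show RV: "R \<subseteq> V" using v(1) w(1) frame_V unfolding R_def by blast
    have "u \<noteq> v" using no v(2) by blast
    moreover have "u \<noteq> w" using u(1) w(1) frame_disj[of i i False True] by blast
    moreover have "u \<notin> Y l c" if "l \<noteq> i" for l c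
      using u(1) frame_disj[of i l False c] that by blast
    ultimately show "{u} \<inter> R = {}" unfolding R_def by blast
    show "\<not> cov {u}" using singles uV by blast
    show "\<not> cov {y, u}" if y: "y \<in> R" for y
    proof
      assume c: "cov {y, u}"
      then have "y \<in> X i True"
        using edges[of u i False y] u(1) frame_sub y RV by (auto simp: insert_commute)
      moreover have "y \<noteq> w" using c no by (auto simp: insert_commute)
      ultimately show False
        using y v(1) frame_sub X_disj unfolding R_def by blast
    qed
  qed
  then obtain p where p: "half_packing {u} R p" by blast
  have cvw: "cov ({u} \<union> {v, w})" using v(2) by (rule hits_mono) auto
  have half: "sum p {A \<in> \<C>. w \<in> A} = 1 / 2"
    using half_packing_edge(2)[OF p _ _ cvw] unfolding R_def by blast
  have "\<exists>A. p A \<noteq> 0 \<and> w \<notin> A"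
  proof (rule ccontr)
    assume "\<not> ?thesis"
    then have "sum p {A \<in> \<C>. w \<in> A} = sum p \<C>" using fin\<C> by (intro sum.mono_neutral_left) auto
    then show False using half p unfolding half_packing_def by simp
  qed
  then obtain A where A: "p A \<noteq> 0" "w \<notin> A" by blast
  have AC: "A \<in> \<C>" "u \<notin> A" using p A(1) unfolding half_packing_def by blast+
  obtain pj pk where s: "side Y A j pj" "side Y A ?k pk"
    using frame_half_packing_side[OF p A(1) YR] ij k by metis
  have "cov ({u} \<union> Y j False \<union> Y ?k (False \<noteq> False))"
    using u(2)[unfolded good_def, rule_format, of j False] ij by auto
  then obtain y z where yz: "y \<in> Y j False" "z \<in> Y ?k (False \<noteq> False)" "cov {u, y, z}"
    using line_triple[OF u(1) ij] by blast
  have "cov ({u} \<union> {y, z})" using yz(3) by (rule hits_mono) auto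
  moreover have "y \<in> R" using YR[OF ij[symmetric]] yz(1) by (rule subsetD)
  moreover have "z \<in> R" using YR[OF k(1)] yz(2) by (rule subsetD)
  ultimately have "y \<in> A \<longleftrightarrow> z \<notin> A" using half_packing_edge(3)[OF p _ _ _ A(1)] by blast
  then have "pj \<noteq> pk" using side_mem[OF s(1) yz(1)] side_mem[OF s(2) yz(2)] by auto
  have "cov ({w} \<union> Y j (\<not> pj) \<union> Y ?k (True \<noteq> (\<not> pj)))"
    using w(2)[unfolded good_def, rule_format, of j "\<not> pj"] ij by auto
  then have "({w} \<union> Y j (\<not> pj) \<union> Y ?k pj) \<inter> A \<noteq> {}" using AC(1) unfolding hits_def by simp
  then have "Y ?k pj \<inter> A \<noteq> {}" using A(2) s(1) unfolding side_def by blast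
  then show False using s(2) \<open>pj \<noteq> pk\<close> side_mem[OF s(2)] by blast
qed

text \<open>Good vertices on the two sides are adjacent, so the component can shrink to this edge.
  Goodness is the cover condition for the lines through \<open>i\<close>, up to which of the three
  positions on the line \<open>i\<close> occupies.\<close>

lemma frame_shrink:
  assumes card: "4 \<le> CARD('r)"
  shows "\<exists>u w. frame (Y(i := (\<lambda>b. if b then {w} else {u})))"
proof -
  obtain u where u: "u \<in> Y i False" "good i False u" using exists_good[OF card] by blast
  obtain w where w: "w \<in> Y i True" "good i True w" using exists_good[OF card] by blast
  have "\<exists>j. i \<noteq> j"
  proof (rule ccontr)
    assume "\<not> ?thesis"
    then have "(UNIV :: 'r set) = {i}" by auto
    then have "CARD('r) = card {i}" by (rule arg_cong)
    then show False using card by simp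
  qed
  then obtain j where "i \<noteq> j" by blast
  then have uw: "cov {u, w}" using good_adjacent u w by blast
  define x where "x = (\<lambda>b. if b then w else u)"
  define Z where "Z = Y(i := (\<lambda>b. {x b}))"
  have x: "x b \<in> Y i b" "good i b (x b)" "cov {x b, x (\<not> b)}" for b
    using u w uw unfolding x_def by (auto simp: insert_commute)
  have Zi: "Z i b = {x b}" for b unfolding Z_def by simp
  have Zl: "Z l b = Y l b" if "l \<noteq> i" for l b using that unfolding Z_def by simp
  have good: "cov ({x a} \<union> Y m d \<union> Y (third i m) (a \<noteq> d))" if "m \<noteq> i" for a m d
    using x(2) that unfolding good_def by blast
  have "frame Z"
    unfolding frame_def
  proof (intro conjI allI impI)
    fix l b
    show "Z l b \<subseteq> X l b" using frame_sub x(1) by (cases "l = i") (auto simp: Zi Zl)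
    show "Z l b \<noteq> {}" using frame_ne by (cases "l = i") (auto simp: Zi Zl)
    show "alt_conn {} (Z l b) (Z l (\<not> b))"
    proof (cases "l = i")
      case True
      \<comment> \<open>Each side is a single vertex, and the walk of length zero suffices.\<close>
      then show ?thesis
        unfolding alt_conn_def by (auto simp: Zi intro!: exI[of _ "\<lambda>_. x b"] exI[of _ 0])
    qed (simp add: Zl frame_conn)
    show "\<forall>y\<in>Z l b. \<exists>z\<in>Z l (\<not> b). cov {y, z}"
      using frame_nbr x(3) by (cases "l = i") (auto simp: Zi Zl)
  next
    fix p q :: 'r and a b assume pq: "p \<noteq> q"
    note t = third(1,2)[OF pq]
    consider "p = i" | "q = i" | "p \<noteq> i" "q \<noteq> i" "third p q = i" | "p \<noteq> i" "q \<noteq> i" "third p q \<noteq> i"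
      by blast
    then show "cov (Z p a \<union> Z q b \<union> Z (third p q) (a \<noteq> b))"
    proof cases
      case 1
      then show ?thesis using good[of q a b] pq t by (simp add: Zi Zl)
    next
      case 2
      have "cov ({x b} \<union> Y p a \<union> Y (third i p) (b \<noteq> a))" using good pq 2 by blast
      moreover have "third i p = third p q" using third_commute[OF pq] 2 by simp
      ultimately have "cov ({x b} \<union> Y p a \<union> Y (third p q) (a \<noteq> b))" by (cases a; cases b) simp_all
      then have "cov (Y p a \<union> {x b} \<union> Y (third p q) (a \<noteq> b))" by (simp add: Un_commute)
      then show ?thesis using pq t 2 by (simp add: Zi Zl)
    next
      case 3
      have q: "third i p = q"
        using third_third[OF pq] third_commute[of i p] 3 by auto
      have "cov ({x (a \<noteq> b)} \<union> Y p a \<union> Y q ((a \<noteq> b) \<noteq> a))" using good[of p "a \<noteq> b" a] 3 q by simp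
      moreover have "((a \<noteq> b) \<noteq> a) = b" by auto
      ultimately have "cov (Y p a \<union> Y q b \<union> {x (a \<noteq> b)})" by (auto elim!: hits_mono)
      then show ?thesis using 3 by (simp add: Zi Zl)
    next
      case 4
      then show ?thesis using frame_line[OF pq] by (simp add: Zl)
    qed
  qed
  moreover have "Z = Y(i := (\<lambda>b. if b then {w} else {u}))" unfolding Z_def x_def by (auto simp: fun_eq_iff)
  ultimately show ?thesis by blast
qed

end

lemma exists_singleton_frame:
  assumes card: "4 \<le> CARD('r)"
  shows "\<exists>Y. frame Y \<and> (\<forall>i b. \<exists>x. Y i b = {x})"
proof -
  have "\<exists>Y. frame Y \<and> (\<forall>i\<in>S. \<forall>b. \<exists>x. Y i b = {x})" if "finite S" for S :: "'r set"
    using that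
  proof induction
    case empty
    then show ?case using frame_X by blast
  next
    case (insert i S)
    then obtain Y where Y: "frame Y" "\<forall>i\<in>S. \<forall>b. \<exists>x. Y i b = {x}" by blast
    obtain u w where "frame (Y(i := (\<lambda>b. if b then {w} else {u})))"
      using frame_shrink[OF Y(1) card] by blast
    moreover have "\<forall>l\<in>insert i S. \<forall>b. \<exists>x. (Y(i := (\<lambda>b. if b then {w} else {u}))) l b = {x}"
      using Y(2) by auto
    ultimately show ?case by blast
  qed
  from this[of UNIV] show ?thesis by simp
qed

text \<open>Since \<open>False \<noteq> False\<close> is \<open>False\<close>, the sides
  \<open>False\<close> of the three components on a line form a line cover; this is what the
  orientation by \<open>A0\<close> achieves.\<close>

lemma exists_transversal:
  assumes card: "4 \<le> CARD('r)"
  obtains x where "\<And>i. x i \<in> X i False" "\<And>i j. i \<noteq> j \<Longrightarrow> cov {x i, x j, x (third i j)}"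
proof -
  obtain Y where Y: "frame Y" "\<And>i b. \<exists>x. Y i b = {x}" using exists_singleton_frame[OF card] by blast
  define x where "x = (\<lambda>i. the_elem (Y i False))"
  have x: "Y i False = {x i}" for i
  proof -
    obtain y where "Y i False = {y}" using Y(2) by blast
    then show ?thesis unfolding x_def by simp
  qed
  show thesis
  proof
    show "x i \<in> X i False" for i using frame_sub[OF Y(1), of i False] x by auto
    show "cov {x i, x j, x (third i j)}" if "i \<noteq> j" for i j
      using frame_line[OF Y(1) that, of False False] x by (simp add: insert_commute)
  qed
qed

end

section \<open>The Fano minor\<close>

context simplex_core
begin

text \<open>The indices 1, 2, 4 are independent coordinates and the others are the sums that the lines of
  \<open>L7\<close> prescribe.\<close>

definition pattern :: "bool \<Rightarrow> bool \<Rightarrow> bool \<Rightarrow> nat \<Rightarrow> bool" where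
  "pattern a b c n = (if n = 1 then a else if n = 2 then b else if n = 3 then a \<noteq> b
     else if n = 4 then c else if n = 5 then a \<noteq> c else if n = 6 then (a \<noteq> b) \<noteq> c else b \<noteq> c)"

lemma pattern_simps:
  "pattern a b c 1 = a" "pattern a b c 2 = b" "pattern a b c 3 = (a \<noteq> b)" "pattern a b c 4 = c"
  "pattern a b c 5 = (a \<noteq> c)" "pattern a b c 6 = ((a \<noteq> b) \<noteq> c)" "pattern a b c 7 = (b \<noteq> c)"
  by (simp_all add: pattern_def)

lemma seven: "n \<in> {1..7::nat} \<longleftrightarrow> n = 1 \<or> n = 2 \<or> n = 3 \<or> n = 4 \<or> n = 5 \<or> n = 6 \<or> n = 7"
  by auto

text \<open>The indices correspond to the seven nonzero vectors over the two-element field in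
  dimension three, and evaluating at the three unit vectors reads off the entries.\<close>

lemma pattern_decode:
  assumes "n \<in> {1..7}"
  shows "n = (if pattern True False False n
     then if pattern False True False n then if pattern False False True n then 6 else 3
       else if pattern False False True n then 5 else 1
     else if pattern False True False n then if pattern False False True n then 7 else 2 else 4)"
  using assms unfolding seven by (elim disjE) (simp_all add: pattern_def)

lemma pattern_inject:
  assumes "p \<in> {1..7}" "q \<in> {1..7}" "\<And>a b c. pattern a b c p = pattern a b c q"
  shows "p = q"
  using pattern_decode[OF assms(1)] pattern_decode[OF assms(2)] unfolding assms(3) by (rule trans[OF _ sym])

text \<open>Three coordinates not on a line take all eight bit patterns by
  \<open>exists_triple\<close>, and the other four are sums of them on every core member. Distinct
  indices have distinct patterns, and lines are recognised by \<open>third_unique\<close>.\<close>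

lemma exists_fano_indices:
  assumes card: "4 \<le> CARD('r)"
  obtains f :: "nat \<Rightarrow> 'r" where "inj_on f {1..7}"
    and "\<And>p q r. p \<in> {1..7} \<Longrightarrow> q \<in> {1..7} \<Longrightarrow> r \<in> {1..7} \<Longrightarrow>
      (\<And>a b c. pattern a b c r = (pattern a b c p \<noteq> pattern a b c q)) \<Longrightarrow> third (f p) (f q) = f r"
    and "\<And>a b c. \<exists>B\<in>K. \<forall>n\<in>{1..7}. val B (f n) = pattern a b c n"
proof -
  have fresh: "\<exists>j. j \<notin> S" if "card S < 4" for S :: "'r set"
    using exists_not_in that card by (meson less_le_trans)
  obtain i :: 'r where True by blast
  have "\<exists>j. j \<notin> {i}" by (rule fresh) simp
  then obtain j where "j \<notin> {i}" by blast
  then have ij: "i \<noteq> j" by auto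
  have "card {i, j, third i j} < 4" using ij third(1,2)[OF ij] by simp
  then obtain m where m: "m \<noteq> i" "m \<noteq> j" "m \<noteq> third i j" using fresh by blast
  define f where "f = (\<lambda>n::nat. if n = 1 then i else if n = 2 then j else if n = 3 then third i j
     else if n = 4 then m else if n = 5 then third i m else if n = 6 then third (third i j) m else third j m)"
  have f: "f 1 = i" "f 2 = j" "f 3 = third i j" "f 4 = m" "f 5 = third i m"
    "f 6 = third (third i j) m" "f 7 = third j m"
    by (simp_all add: f_def)
  have val: "val B (f n) = pattern (val B i) (val B j) (val B m) n" if "B \<in> K" "n \<in> {1..7}" for B n
    using that(2) third(3)[OF ij that(1)] third(3)[OF m(1)[symmetric] that(1)]
      third(3)[OF m(2)[symmetric] that(1)] third(3)[OF m(3)[symmetric] that(1)]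
    unfolding seven by (elim disjE) (simp_all add: f pattern_simps del: One_nat_def)
  have ex: "\<exists>B\<in>K. \<forall>n\<in>{1..7}. val B (f n) = pattern a b c n" for a b c
  proof -
    obtain B where B: "B \<in> K" "val B i = a" "val B j = b" "val B m = c"
      using exists_triple[OF ij m, of a b c] by blast
    then have "\<forall>n\<in>{1..7}. val B (f n) = pattern a b c n" using val[OF B(1)] by simp
    then show ?thesis using B(1) by blast
  qed
  show thesis
  proof
    show "\<exists>B\<in>K. \<forall>n\<in>{1..7}. val B (f n) = pattern a b c n" for a b c by (rule ex)
    show "inj_on f {1..7}"
    proof (rule inj_onI)
      fix p q assume pq: "p \<in> {1..7}" "q \<in> {1..7}" "f p = f q"
      show "p = q"
      proof (rule pattern_inject[OF pq(1,2)])
        show "pattern a b c p = pattern a b c q" for a b c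
          using ex[of a b c] pq by metis
      qed
    qed
    show "third (f p) (f q) = f r" if "p \<in> {1..7}" "q \<in> {1..7}" "r \<in> {1..7}"
      "\<And>a b c. pattern a b c r = (pattern a b c p \<noteq> pattern a b c q)" for p q r
      using val that by (intro third_unique) simp
  qed
qed

lemma L7_subset: "l \<in> L7 \<Longrightarrow> l \<subseteq> {1..7}"
  unfolding L7_def by auto

lemma L7_card: "l \<in> L7 \<Longrightarrow> card l = 3"
  unfolding L7_def by auto

text \<open>The traces of members on the seven vertices meet all seven lines, and a set meeting
  every line of the Fano plane contains a line. Conversely each line is the trace of a core member,
  so the minimal traces are the lines.\<close>

lemma has_L7_minor:
  assumes card: "4 \<le> CARD('r)"
  shows "has_minor V \<C> {1..7} L7"
proof -
  obtain f where inj: "inj_on f {1..7::nat}"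
    and third: "\<And>p q r. p \<in> {1..7} \<Longrightarrow> q \<in> {1..7} \<Longrightarrow> r \<in> {1..7} \<Longrightarrow>
      (\<And>a b c. pattern a b c r = (pattern a b c p \<noteq> pattern a b c q)) \<Longrightarrow> third (f p) (f q) = f r"
    and ex: "\<And>a b c. \<exists>B\<in>K. \<forall>n\<in>{1..7}. val B (f n) = pattern a b c n"
    using exists_fano_indices[OF card] by metis
  obtain x where x: "\<And>i. x i \<in> X i False" "\<And>i j. i \<noteq> j \<Longrightarrow> cov {x i, x j, x (third i j)}"
    using exists_transversal[OF card] by metis
  define g where "g = (\<lambda>n. x (f n))"
  have xinj: "i = j" if "x i = x j" for i j using x(1)[of i] x(1)[of j] that X_disj by metis
  have ginj: "inj_on g {1..7}"
    unfolding g_def by (intro inj_onI) (meson xinj inj inj_onD)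
  have line3: "cov {g p, g q, g r}" if "p \<in> {1..7}" "q \<in> {1..7}" "r \<in> {1..7}" "p \<noteq> q"
    "\<And>a b c. pattern a b c r = (pattern a b c p \<noteq> pattern a b c q)" for p q r
  proof -
    have "f p \<noteq> f q" using inj that(1,2,4) by (auto dest: inj_onD)
    then show ?thesis using x(2)[of "f p" "f q"] third[OF that(1,2,3,5)] unfolding g_def by simp
  qed
  have lines: "cov {g 1, g 2, g 3}" "cov {g 1, g 4, g 5}" "cov {g 1, g 6, g 7}" "cov {g 2, g 5, g 6}"
    "cov {g 2, g 4, g 7}" "cov {g 3, g 4, g 6}" "cov {g 3, g 5, g 7}"
    by (rule line3; simp only: seven pattern_simps; auto)+
  define J where "J = V - g ` {1..7}"
  have gV: "g ` {1..7} \<subseteq> V" using x(1) XV unfolding g_def by blast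
  have minus: "A - J = A \<inter> g ` {1..7}" if "A \<in> \<C>" for A using that sub gV unfolding J_def by blast
  have min: "minor \<C> {} J = (`) g ` L7"
    unfolding minor_def
  proof (rule minimal_sets_eqI)
    fix B assume "B \<in> {A - J |A. A \<in> \<C> \<and> A \<inter> {} = {}}"
    then obtain A where A: "A \<in> \<C>" "B = A \<inter> g ` {1..7}" using minus by blast
    have hit: "g p \<in> A \<or> g q \<in> A \<or> g r \<in> A" if "cov {g p, g q, g r}" for p q r
      using that A(1) unfolding hits_def by blast
    have "(g 1 \<in> A \<and> g 2 \<in> A \<and> g 3 \<in> A) \<or> (g 1 \<in> A \<and> g 4 \<in> A \<and> g 5 \<in> A) \<or>
        (g 1 \<in> A \<and> g 6 \<in> A \<and> g 7 \<in> A) \<or> (g 2 \<in> A \<and> g 5 \<in> A \<and> g 6 \<in> A) \<or>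
        (g 2 \<in> A \<and> g 4 \<in> A \<and> g 7 \<in> A) \<or> (g 3 \<in> A \<and> g 4 \<in> A \<and> g 6 \<in> A) \<or>
        (g 3 \<in> A \<and> g 5 \<in> A \<and> g 7 \<in> A)"
      using hit[OF lines(1)] hit[OF lines(2)] hit[OF lines(3)] hit[OF lines(4)] hit[OF lines(5)]
        hit[OF lines(6)] hit[OF lines(7)] by argo
    then have "\<exists>l\<in>L7. g ` l \<subseteq> A" unfolding L7_def by simp
    then obtain l where l: "l \<in> L7" "g ` l \<subseteq> A" by blast
    then have "g ` l \<subseteq> B" using A(2) image_mono[OF L7_subset[OF l(1)], of g] by simp
    then show "\<exists>M\<in>(`) g ` L7. M \<subseteq> B" using l(1) by blast
  next
    have "\<exists>B\<in>\<C>. g ` l = B - J" if l: "l \<in> L7" for l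
    proof -
      \<comment> \<open>A line is the set of zeros of a nonzero linear form, and the vertex
        \<open>g n\<close>, taken from a side \<open>False\<close>, lies in a core member exactly
        when bit \<open>n\<close> is not set.\<close>
      have "\<exists>a b c. \<forall>n\<in>{1..7}. (\<not> pattern a b c n) = (n \<in> l)"
      proof -
        have pt: "\<forall>n\<in>{1..7}. (\<not> pattern a b c n) = (n \<in> {n \<in> {1..7}. \<not> pattern a b c n})" for a b c
          by blast
        have "l \<in> {{n \<in> {1..7}. \<not> pattern a b c n} |a b c. True}"
        proof -
          have set: "{n \<in> {1..7::nat}. P n} = (if P 1 then {1} else {}) \<union> (if P 2 then {2} else {}) \<union>
             (if P 3 then {3} else {}) \<union> (if P 4 then {4} else {}) \<union> (if P 5 then {5} else {}) \<union>
             (if P 6 then {6} else {}) \<union> (if P 7 then {7} else {})" for P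
            unfolding seven by auto
          have "{1,2,3} = {n \<in> {1..7}. \<not> pattern False False True n}"
            "{1,4,5} = {n \<in> {1..7}. \<not> pattern False True False n}"
            "{1,6,7} = {n \<in> {1..7}. \<not> pattern False True True n}"
            "{2,5,6} = {n \<in> {1..7}. \<not> pattern True False True n}"
            "{2,4,7} = {n \<in> {1..7}. \<not> pattern True False False n}"
            "{3,4,6} = {n \<in> {1..7}. \<not> pattern True True False n}"
            "{3,5,7} = {n \<in> {1..7}. \<not> pattern True True True n}"
            unfolding set pattern_simps by (simp_all add: insert_commute)
          then show ?thesis using l unfolding L7_def by blast
        qed
        then show ?thesis using pt by blast
      qed
      then obtain a b c where p: "\<forall>n\<in>{1..7}. (\<not> pattern a b c n) = (n \<in> l)" by blast
      obtain B where B: "B \<in> K" "\<forall>n\<in>{1..7}. val B (f n) = pattern a b c n" using ex by blast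
      have mem: "g n \<in> B \<longleftrightarrow> n \<in> l" if "n \<in> {1..7}" for n
      proof -
        have "g n \<in> B \<longleftrightarrow> \<not> val B (f n)" using K_mem[OF B(1) x(1)[of "f n"]] unfolding g_def by simp
        then show ?thesis using B(2) p that by simp
      qed
      have "g ` l = B \<inter> g ` {1..7}"
      proof (intro equalityI subsetI)
        fix v assume "v \<in> g ` l"
        then obtain n where n: "v = g n" "n \<in> l" by blast
        then have "n \<in> {1..7}" using L7_subset[OF l] by blast
        then show "v \<in> B \<inter> g ` {1..7}" using n mem[of n] by simp
      next
        fix v assume "v \<in> B \<inter> g ` {1..7}"
        then obtain n where "v = g n" "n \<in> {1..7}" "g n \<in> B" by blast
        then show "v \<in> g ` l" using mem[of n] by simp
      qed
      moreover have "B \<in> \<C>" using B(1) K_C by blast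
      ultimately show ?thesis using minus by (intro bexI[of _ B]) simp_all
    qed
    then show "(`) g ` L7 \<subseteq> {A - J |A. A \<in> \<C> \<and> A \<inter> {} = {}}" by blast
  next
    fix A B assume "A \<in> (`) g ` L7" "B \<in> (`) g ` L7"
    then obtain l l' where l: "A = g ` l" "l \<in> L7" "B = g ` l'" "l' \<in> L7" by blast
    have "card (g ` l) = 3" if "l \<in> L7" for l
      using card_image[OF inj_on_subset[OF ginj L7_subset[OF that]]] L7_card[OF that] by simp
    moreover have "finite B" using l L7_subset finite_subset by blast
    ultimately show "\<not> A \<subset> B" using l psubset_card_mono[of B A] by auto
  qed
  have ground: "V - ({} \<union> J) = g ` {1..7}" using gV unfolding J_def by blast
  have "bij_betw (inv_into {1..7} g) (g ` {1..7}) {1..7}"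
    using ginj by (simp add: bij_betw_inv_into bij_betw_imageI)
  moreover have "(`) (inv_into {1..7} g) ` (`) g ` L7 = L7"
  proof -
    have "inv_into {1..7} g ` g ` l = l" if "l \<in> L7" for l
      using inv_into_image_cancel[OF ginj L7_subset[OF that]] .
    then show ?thesis by (simp add: image_image)
  qed
  ultimately have "clutter_iso (V - ({} \<union> J)) (minor \<C> {} J) {1..7} L7"
    unfolding clutter_iso_def ground min by blast
  then show ?thesis unfolding has_minor_def J_def by blast
qed

end

section \<open>Simplices spanned by points of the cube\<close>

lemma convex_combination_0_1:
  fixes a b u :: real
  assumes "0 \<le> a" "a \<le> 1" "0 \<le> b" "b \<le> 1" "0 < u" "u < 1" "(1 - u) * a + u * b \<in> {0, 1}"
  shows "a = b"
proof -
  have nn: "0 \<le> (1 - u) * a" "0 \<le> u * b" "0 \<le> (1 - u) * (1 - a)" "0 \<le> u * (1 - b)"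
    using assms by simp_all
  from assms(7) consider "(1 - u) * a + u * b = 0" | "(1 - u) * (1 - a) + u * (1 - b) = 0"
    by (auto simp: algebra_simps)
  then show ?thesis
  proof cases
    case 1
    then have "(1 - u) * a = 0" "u * b = 0" using nn by linarith+
    then show ?thesis using assms(5,6) by simp
  next
    case 2
    then have "(1 - u) * (1 - a) = 0" "u * (1 - b) = 0" using nn by linarith+
    then show ?thesis using assms(5,6) by simp
  qed
qed

text \<open>A 0/1 point is not interior to any segment in the cube, so every point of
  \<open>S\<close> is extreme in the hull and hence belongs to the vertex set \<open>C\<close> of
  the simplex. Subsets of affinely independent sets are affinely independent.\<close>

lemma affinely_independent_if_simplex:
  fixes S :: "(real ^ 'r::finite) set"
  assumes cube: "\<And>p i. p \<in> S \<Longrightarrow> p $ i \<in> {0, 1}" and simplex: "int n simplex (convex hull S)"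
  shows "\<not> affine_dependent S" "S \<noteq> {}"
proof -
  obtain C where C: "\<not> affine_dependent C" "int (card C) = int n + 1" "convex hull S = convex hull C"
    using simplex unfolding simplex_def by blast
  have "0 \<le> p $ i \<and> p $ i \<le> 1" if "p \<in> S" for p i using cube[OF that, of i] by auto
  then have "S \<subseteq> cbox 0 1" by (auto simp: mem_box_cart)
  then have hull: "convex hull S \<subseteq> cbox 0 1" by (rule hull_minimal) (rule convex_box)
  have "p \<in> C" if p: "p \<in> S" for p
  proof (rule extreme_point_of_convex_hull)
    show "p extreme_point_of convex hull C"
      unfolding extreme_point_of_def C(3)[symmetric]
    proof (intro conjI ballI notI)
      show "p \<in> convex hull S" using p by (rule hull_inc)
      fix a b assume ab: "a \<in> convex hull S" "b \<in> convex hull S" "p \<in> open_segment a b"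
      then obtain u where u: "a \<noteq> b" "0 < u" "u < 1" "p = (1 - u) *\<^sub>R a + u *\<^sub>R b"
        unfolding in_segment by blast
      have "a $ i = b $ i" for i
      proof (rule convex_combination_0_1)
        show "0 \<le> a $ i" "a $ i \<le> 1" "0 \<le> b $ i" "b $ i \<le> 1"
          using ab(1,2) hull by (auto simp: mem_box_cart subset_iff)
        show "(1 - u) * a $ i + u * b $ i \<in> {0, 1}" using cube[OF p, of i] u(4) by simp
      qed (use u in auto)
      then show False using u(1) by (simp add: vec_eq_iff)
    qed
  qed
  then show "\<not> affine_dependent S" using C(1) affine_dependent_subset by blast
  \<comment> \<open>The dimension is a natural number, which rules out the empty simplex of
    dimension -1.\<close>
  have "C \<noteq> {}" using C(2) by auto
  then show "S \<noteq> {}" using C(3) by (metis convex_hull_eq_empty)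
qed

section \<open>From a clean tangled clutter to the locale \<open>simplex_core\<close>\<close>

theorem theorem1p8:
  fixes V :: "'a set" and \<C> :: "'a set set" and U W :: "'r::finite \<Rightarrow> 'a set"
  assumes "clutter V \<C>" and "clean V \<C>" and "tangled V \<C>"
    and "component_bipartitions V \<C> U W"
    and "\<exists>n::nat. int n simplex (convex hull (setcore V \<C> U W))"
    and "clutter_rank V \<C> > 3"
  shows "has_minor V \<C> {1..7} L7"
proof -
  interpret clean_family V \<C>
    using assms(1,2) unfolding clutter_def clean_family_def by blast
  define E where "E = cover_graph V \<C>"
  have cn: "covering_number V \<C> = 2"
    and tang: "\<And>v. v \<in> V \<Longrightarrow> \<exists>B\<in>minimum_covers V \<C>. v \<in> B"
    using assms(3) unfolding tangled_def by blast+
  have cov_covers: "cov Z \<longleftrightarrow> Z \<in> covers V \<C>" if "Z \<subseteq> V" for Z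
    using that unfolding hits_def covers_def by blast
  have card_cover: "2 \<le> card Z" if "Z \<subseteq> V" "cov Z" for Z
  proof -
    have "covering_number V \<C> \<le> enat (card Z)"
      unfolding covering_number_def using that cov_covers by (intro INF_lower) blast
    then have "enat 2 \<le> enat (card Z)" unfolding cn by (simp add: numeral_eq_enat)
    then show ?thesis by simp
  qed
  have min_cov: "Z \<in> minimum_covers V \<C> \<longleftrightarrow> Z \<subseteq> V \<and> cov Z \<and> card Z = 2" for Z
    using cov_covers[of Z] unfolding minimum_covers_def cn covers_def by (auto simp: numeral_eq_enat)
  have single: "\<not> cov {v}" if "v \<in> V" for v using card_cover[of "{v}"] that by auto
  have E: "(x, y) \<in> E \<longleftrightarrow> x \<in> V \<and> y \<in> V \<and> cov {x, y}" for x y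
  proof -
    have "card {x, y} = 2" if "x \<in> V" "cov {x, y}"
      using single that by (cases "x = y") auto
    then show ?thesis unfolding E_def cover_graph_def using min_cov[of "{x, y}"] by auto
  qed
  have symE: "sym E" using E by (auto simp: sym_def insert_commute)
  define comp where "comp = (\<lambda>i. U i \<union> W i)"
  have bij: "bij_betw comp UNIV (V // E\<^sup>*)"
    and disjUW: "U i \<inter> W i = {}"
    and mono: "(u, v) \<in> E \<Longrightarrow> \<not> (u \<in> U i \<and> v \<in> U i) \<and> \<not> (u \<in> W i \<and> v \<in> W i)" for i u v
    using assms(4) unfolding component_bipartitions_def graph_components_def E_def comp_def by blast+
  have closed: "y \<in> V" if "(x, y) \<in> E\<^sup>*" "x \<in> V" for x y
    using that by (induction rule: rtrancl_induct) (auto simp: E)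
  have symEs: "(y, x) \<in> E\<^sup>*" if "(x, y) \<in> E\<^sup>*" for x y using sym_rtrancl[OF symE] that by (rule symD)
  have comp_class: "comp i = E\<^sup>* `` {x}" if "x \<in> comp i" for i x
  proof -
    have "comp i \<in> V // E\<^sup>*" using bij by (auto simp: bij_betw_def)
    then obtain v where v: "comp i = E\<^sup>* `` {v}" by (auto elim: quotientE)
    then have "(v, x) \<in> E\<^sup>*" using that by simp
    then have "(v, y) \<in> E\<^sup>* \<longleftrightarrow> (x, y) \<in> E\<^sup>*" for y using symEs by (meson rtrancl_trans)
    then show ?thesis unfolding v by blast
  qed
  have compV: "comp i \<subseteq> V" for i
  proof -
    have "comp i \<in> V // E\<^sup>*" using bij by (auto simp: bij_betw_def)
    then show ?thesis using closed by (auto elim!: quotientE)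
  qed
  have comp_ne: "comp i \<noteq> {}" for i
  proof -
    have "comp i \<in> V // E\<^sup>*" using bij by (auto simp: bij_betw_def)
    then show ?thesis by (auto elim!: quotientE)
  qed
  have comp_cover: "\<exists>i. v \<in> comp i" if "v \<in> V" for v
  proof -
    have "E\<^sup>* `` {v} \<in> V // E\<^sup>*" using that by (rule quotientI)
    then have "E\<^sup>* `` {v} \<in> range comp" using bij by (simp add: bij_betw_def)
    then obtain i where "comp i = E\<^sup>* `` {v}" by (metis rangeE)
    then show ?thesis by auto
  qed
  have comp_disj: "i = j" if "v \<in> comp i" "v \<in> comp j" for i j v
    using comp_class that bij unfolding bij_betw_def by (metis injD)
  have E_comp: "y \<in> comp i" if "x \<in> comp i" "(x, y) \<in> E" for x y i
    using comp_class[OF that(1)] that(2) by auto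
  define S where "S = (\<lambda>i b. if b then W i else U i)"
  have S_comp: "comp i = S i b \<union> S i (\<not> b)" for i b unfolding S_def comp_def by auto
  have S_sub: "S i b \<subseteq> comp i" for i b using S_comp by blast
  have S_dj: "S i b \<inter> S i (\<not> b) = {}" for i b using disjUW[of i] unfolding S_def by auto
  have S_edge: "y \<in> S i (\<not> b)" if "x \<in> S i b" "(x, y) \<in> E" for x y i b
  proof -
    have "y \<notin> S i b" using mono[OF that(2), of i] that(1) unfolding S_def by (auto split: if_splits)
    moreover have "y \<in> comp i" using E_comp S_sub that by blast
    ultimately show ?thesis using S_comp by blast
  qed
  have V_nbr: "\<exists>y. (x, y) \<in> E" if x: "x \<in> V" for x
  proof -
    obtain B where B: "B \<in> minimum_covers V \<C>" "x \<in> B" using tang[OF x] by blast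
    then have "card B = 2" "B \<subseteq> V" "cov B" using min_cov by blast+
    then obtain y where "B = {x, y}" using B(2) by (auto simp: card_2_iff)
    then show ?thesis using E \<open>B \<subseteq> V\<close> \<open>cov B\<close> by blast
  qed
  have S_nbr: "\<exists>y\<in>S i (\<not> b). cov {x, y}" if "x \<in> S i b" for x i b
  proof -
    have "x \<in> V" using that S_sub compV by blast
    then obtain y where "(x, y) \<in> E" using V_nbr by blast
    then show ?thesis using S_edge[OF that] E by blast
  qed
  have S_ne: "S i b \<noteq> {}" for i b
  proof -
    obtain v where "v \<in> comp i" using comp_ne by blast
    then have "v \<in> S i b \<or> v \<in> S i (\<not> b)" using S_comp by blast
    then show ?thesis using S_nbr[of v i b] S_nbr[of v i "\<not> b"] by auto
  qed
  have S_disj: "i = j \<and> a = b" if "v \<in> S i a" "v \<in> S j b" for v i j a b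
  proof -
    have ij: "i = j" using comp_disj S_sub that by blast
    have "a = b"
    proof (rule ccontr)
      assume "a \<noteq> b"
      then have "b = (\<not> a)" by blast
      then show False using that ij S_dj[of i a] by blast
    qed
    then show ?thesis using ij by blast
  qed
  have S_conn: "alt_conn {} (S i b) (S i (\<not> b))" for i b
    unfolding alt_conn_def
  proof (intro ballI)
    fix f g assume fg: "f \<in> S i b" "g \<in> S i b"
    then have "(f, g) \<in> E\<^sup>*" using comp_class[of f i] S_sub by blast
    then obtain n where "(f, g) \<in> E ^^ n" using rtrancl_imp_relpow by blast
    then obtain x where x: "x 0 = f" "x n = g" "\<And>t. t < n \<Longrightarrow> (x t, x (Suc t)) \<in> E"
      unfolding relpow_fun_conv by blast
    have alt: "x t \<in> (if even t then S i b else S i (\<not> b))" if "t \<le> n" for t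
      using that
    proof (induction t)
      case 0
      then show ?case using x(1) fg by simp
    next
      case (Suc t)
      then show ?case
        using S_edge[of "x t" i b "x (Suc t)"] S_edge[of "x t" i "\<not> b" "x (Suc t)"] x(3)[of t] by (cases "even t") auto
    qed
    \<comment> \<open>Every edge changes side, so a walk between vertices of one side is
      even.\<close>
    have "even n"
      using alt[of n] x(2) fg(2) S_dj[of i b] by (cases "even n") auto
    then obtain m where "n = 2 * m" by (rule evenE)
    then show "\<exists>m x. x 0 = f \<and> x (2 * m) = g \<and> (\<forall>t\<le>2 * m. x t \<in> (if even t then S i b else S i (\<not> b))) \<and>
        (\<forall>t<2 * m. cov ({} \<union> {x t, x (Suc t)}))"
      using x alt E by (intro exI[of _ m] exI[of _ x]) auto
  qed
  define K where "K = {A. \<exists>w. half_packing {} V w \<and> w A \<noteq> 0}"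
  have KC: "K \<subseteq> \<C>" unfolding K_def half_packing_def by blast
  have finK: "finite K" using KC fin\<C> finite_subset by blast
  have core: "clutter_core V \<C> = K"
  proof (intro equalityI subsetI)
    fix A assume "A \<in> clutter_core V \<C>"
    then obtain y where A: "A \<in> \<C>" and y: "fractional_packing V \<C> y" "sum y \<C> = 2" "0 < y A"
      unfolding clutter_core_def by blast
    \<comment> \<open>A fractional packing is arbitrary outside \<C>, whereas
      \<open>half_packing\<close> asks for weight 0 there.\<close>
    define w where "w = (\<lambda>B. if B \<in> \<C> then y B / 2 else 0)"
    have sum_w: "sum w T = sum y T / 2" if "T \<subseteq> \<C>" for T
      unfolding w_def sum_divide_distrib using that by (intro sum.cong) auto
    have "half_packing {} V w"
      unfolding half_packing_def
    proof (intro conjI allI impI ballI)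
      show "0 \<le> w B" for B using y(1) unfolding fractional_packing_def w_def by simp
      show "B \<in> \<C>" if "w B \<noteq> 0" for B using that unfolding w_def by metis
      show "sum w \<C> = 1" using sum_w[of \<C>] y(2) by simp
      show "sum w {B \<in> \<C>. v \<in> B} \<le> 1 / 2" if "v \<in> V" for v
        using sum_w[of "{B \<in> \<C>. v \<in> B}"] y(1) that unfolding fractional_packing_def by simp
    qed simp
    moreover have "w A \<noteq> 0" using A y(3) unfolding w_def by simp
    ultimately show "A \<in> K" unfolding K_def by blast
  next
    fix A assume "A \<in> K"
    then obtain w where w: "half_packing {} V w" "w A \<noteq> 0" unfolding K_def by blast
    have "fractional_packing V \<C> (\<lambda>B. 2 * w B)"
      unfolding fractional_packing_def
    proof (intro conjI ballI)
      show "0 \<le> 2 * w B" for B using w(1) unfolding half_packing_def by simp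
      fix v assume "v \<in> V"
      then have "sum w {A \<in> \<C>. v \<in> A} \<le> 1 / 2" using w(1) unfolding half_packing_def by blast
      then show "(\<Sum>A\<in>{A \<in> \<C>. v \<in> A}. 2 * w A) \<le> 1" by (simp add: sum_distrib_left[symmetric])
    qed
    moreover have "(\<Sum>B\<in>\<C>. 2 * w B) = 2"
      using w(1) unfolding half_packing_def by (simp add: sum_distrib_left[symmetric])
    moreover have "0 < 2 * w A" using w unfolding half_packing_def by (simp add: order_less_le)
    ultimately show "A \<in> clutter_core V \<C>"
      unfolding clutter_core_def using \<open>A \<in> K\<close> KC by blast
  qed
  have K_side: "side S A i (W i \<subseteq> A)" if A: "A \<in> K" for A i
  proof -
    obtain w where w: "half_packing {} V w" "w A \<noteq> 0" using A unfolding K_def by blast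
    have SV: "S i b \<subseteq> V" for b using S_sub compV by blast
    have nbr': "\<exists>x\<in>S i True. cov {x, y}" if "y \<in> S i False" for y
      using S_nbr[of y i False] that by (auto simp: insert_commute)
    have "S i True \<subseteq> A \<and> S i False \<inter> A = {} \<or> S i False \<subseteq> A \<and> S i True \<inter> A = {}"
      using half_packing_side[OF w SV SV, of True False] S_conn[of i True] S_nbr[of _ i True] nbr' by simp
    moreover have "S i True = W i" unfolding S_def by simp
    ultimately show ?thesis using S_ne[of i True] unfolding side_def by (cases "W i \<subseteq> A") auto
  qed
  define pt where "pt = (\<lambda>A. (\<chi> i. of_bool (W i \<subseteq> A)) :: real ^ 'r)"
  have pt: "pt A $ i = of_bool (W i \<subseteq> A)" for A i unfolding pt_def by simp
  have K_cap: "A \<inter> comp i = (if W i \<subseteq> A then W i else U i)" if A: "A \<in> K" for A i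
    using K_side[OF A, of i] unfolding side_def comp_def S_def by (auto split: if_splits)
  have UW: "U i \<noteq> W i" for i using S_dj[of i True] S_ne[of i True] unfolding S_def by auto
  have setcore: "setcore V \<C> U W = pt ` K"
  proof -
    have "(A \<inter> (U i \<union> W i) = U i \<and> p $ i = 0 \<or> A \<inter> (U i \<union> W i) = W i \<and> p $ i = 1) \<longleftrightarrow> p $ i = pt A $ i"
      if "A \<in> K" for A p i
      using K_cap[OF that, of i] UW[of i] unfolding comp_def pt by auto
    then have "setcore V \<C> U W = {p. \<exists>A\<in>K. \<forall>i. p $ i = pt A $ i}"
      unfolding setcore_def core by (metis (lifting))
    then show ?thesis by (auto simp: vec_eq_iff[symmetric])
  qed
  \<comment> \<open>The components cover \<open>V\<close>, so a core member is determined by its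
    sides, and sums over points can be reindexed by members.\<close>
  have inj_pt: "inj_on pt K"
  proof (rule inj_onI)
    fix A B assume AB: "A \<in> K" "B \<in> K" "pt A = pt B"
    have eq: "A \<inter> comp i = B \<inter> comp i" for i
    proof -
      have "pt A $ i = pt B $ i" using AB(3) by simp
      then have "W i \<subseteq> A \<longleftrightarrow> W i \<subseteq> B" unfolding pt by (simp only: of_bool_eq_iff)
      then show ?thesis using K_cap AB(1,2) by simp
    qed
    have "A \<subseteq> V" "B \<subseteq> V" using AB KC sub by blast+
    then show "A = B" using eq comp_cover by blast
  qed
  obtain n where "int n simplex (convex hull (pt ` K))" using assms(5) unfolding setcore by blast
  moreover have "p $ i \<in> {0, 1}" if "p \<in> pt ` K" for p i using that by (auto simp: pt)
  ultimately have indep: "\<not> affine_dependent (pt ` K)" and ne: "pt ` K \<noteq> {}"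
    using affinely_independent_if_simplex[of "pt ` K" n] by blast+
  have K_indep: "\<gamma> A = 0"
    if \<gamma>: "(\<Sum>A\<in>K. \<gamma> A) = 0" "\<And>i. (\<Sum>A\<in>K. \<gamma> A * of_bool (W i \<subseteq> A)) = (0::real)" and A: "A \<in> K" for \<gamma> A
  proof (rule ccontr)
    assume nz: "\<gamma> A \<noteq> 0"
    define u where "u = (\<lambda>p. \<gamma> (inv_into K pt p))"
    have u: "u (pt B) = \<gamma> B" if "B \<in> K" for B
      unfolding u_def using inv_into_f_f[OF inj_pt that] by simp
    have "sum u (pt ` K) = 0"
      using \<gamma>(1) u by (simp add: sum.reindex[OF inj_pt])
    moreover have "(\<Sum>p\<in>pt ` K. u p *\<^sub>R p) = 0"
    proof -
      have "(\<Sum>p\<in>pt ` K. u p *\<^sub>R p) = (\<Sum>B\<in>K. \<gamma> B *\<^sub>R pt B)"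
        using u by (simp add: sum.reindex[OF inj_pt])
      moreover have "(\<Sum>B\<in>K. \<gamma> B *\<^sub>R pt B) $ i = 0" for i
        using \<gamma>(2)[of i] by (simp add: pt)
      ultimately show ?thesis by (simp add: vec_eq_iff)
    qed
    moreover have "\<exists>p\<in>pt ` K. u p \<noteq> 0"
      using u[OF A] A nz by (intro bexI[of _ "pt A"]) simp_all
    ultimately have "affine_dependent (pt ` K)"
      using finK by (subst affine_dependent_explicit_finite) auto
    then show False using indep by blast
  qed
  obtain A0 where A0: "A0 \<in> K" using ne by blast
  \<comment> \<open>The flip by \<open>W i \<subseteq> A0\<close> gives the side inside
    \<open>A0\<close> the index \<open>False\<close>.\<close>
  define X where "X = (\<lambda>i b. S i (b \<noteq> (W i \<subseteq> A0)))"
  have neg: "S i ((\<not> b) \<noteq> c) = S i (\<not> (b \<noteq> c))" for i b c by (rule arg_cong) auto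
  interpret simplex_core V \<C> X K A0
  proof
    show "(\<Union>i b. X i b) = V"
    proof
      show "(\<Union>i b. X i b) \<subseteq> V" unfolding X_def using S_sub compV by blast
      show "V \<subseteq> (\<Union>i b. X i b)"
      proof
        fix v assume "v \<in> V"
        then obtain i where "v \<in> comp i" using comp_cover by blast
        then have "v \<in> X i True \<or> v \<in> X i False"
          using S_comp[of i "\<not> (W i \<subseteq> A0)"] unfolding X_def by auto
        then show "v \<in> (\<Union>i b. X i b)" by blast
      qed
    qed
    show "i = j \<and> a = b" if "v \<in> X i a" "v \<in> X j b" for v i j a b
      using S_disj[of v i _ j] that unfolding X_def by blast
    show "X i b \<noteq> {}" for i b unfolding X_def by (rule S_ne)
    show "\<not> cov {v}" if "v \<in> V" for v using single that .
    show "y \<in> X i (\<not> a)" if "x \<in> X i a" "y \<in> V" "cov {x, y}" for x i a y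
    proof -
      have "x \<in> V" using that(1) S_sub compV unfolding X_def by blast
      then have "(x, y) \<in> E" using that E by blast
      then show ?thesis using S_edge that(1) unfolding X_def neg by blast
    qed
    show "\<exists>y\<in>X i (\<not> a). cov {x, y}" if "x \<in> X i a" for x i a
      using S_nbr that unfolding X_def neg by blast
    show "alt_conn {} (X i a) (X i (\<not> a))" for i a unfolding X_def neg by (rule S_conn)
    show "A \<in> K \<longleftrightarrow> (\<exists>w. half_packing {} V w \<and> w A \<noteq> 0)" for A unfolding K_def by blast
    show "\<gamma> A = 0" if \<gamma>: "(\<Sum>A\<in>K. \<gamma> A) = 0"
      "\<And>i. (\<Sum>A\<in>K. \<gamma> A * of_bool (X i True \<subseteq> A)) = 0" "A \<in> K" for \<gamma> :: "'a set \<Rightarrow> real" and A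
    proof (rule K_indep[OF \<gamma>(1) _ \<gamma>(3)])
      fix i
      show "(\<Sum>A\<in>K. \<gamma> A * of_bool (W i \<subseteq> A)) = 0"
      proof (cases "W i \<subseteq> A0")
        case True
        \<comment> \<open>In a flipped coordinate the new bit is one minus the old one, and the
          vanishing total of \<gamma> absorbs the constant.\<close>
        have "\<gamma> A * of_bool (X i True \<subseteq> A) = \<gamma> A - \<gamma> A * of_bool (W i \<subseteq> A)" if "A \<in> K" for A
          using K_side[OF that, of i] S_ne[of i False] True unfolding side_def X_def S_def
          by (cases "W i \<subseteq> A") auto
        then have "(\<Sum>A\<in>K. \<gamma> A * of_bool (X i True \<subseteq> A)) = (\<Sum>A\<in>K. \<gamma> A - \<gamma> A * of_bool (W i \<subseteq> A))"
          by (intro sum.cong) auto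
        then show ?thesis using \<gamma>(1) \<gamma>(2)[of i] by (simp add: sum_subtractf)
      next
        case False
        then show ?thesis using \<gamma>(2)[of i] unfolding X_def S_def by simp
      qed
    qed
    show "A0 \<in> K" by (rule A0)
    show "X i False \<subseteq> A0" for i using K_side[OF A0, of i] unfolding side_def X_def by auto
  qed
  have "CARD('r) = clutter_rank V \<C>"
    using bij_betw_same_card[OF bij] unfolding clutter_rank_def graph_components_def E_def .
  then show ?thesis using assms(6) by (intro has_L7_minor) simp
qed

end
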